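(* Let $n<\infty$ ($n$ a positive integer). The cell systems on $\mathcal{A}^{(4n)\ast}$ are given, up to equivalence, by the two inequivalent solutions $W^+$, $W^-$: $$W^{\pm}_{i,i,i+1}=\frac{\sqrt{[2i][2i+2]}}{[2]\sqrt{[2i+1]}}\sqrt{[2i]\mp[1]},\quad i=1,\ldots,2n-2,$$ $$W^{\pm}_{i,i+1,i+1}=\frac{\sqrt{[2i][2i+2]}}{[2]\sqrt{[2i+1]}}\sqrt{[2i+2]\pm[1]},\quad i=1,\ldots,2n-2,$$ $$W^{\pm}_{i,i,i}=\begin{cases}(-1)^{i+1}\dfrac{\sqrt{[2i]}}{[2]\sqrt{[2i-1][2i+1]}}\sqrt{[2][2i]\pm[4i]}, & i=1,\ldots,n-1,\\[2mm](-1)^{n+1}\dfrac{[2n]}{\sqrt{[2][2n-1][2n+1]}}, & i=n,\\[2mm](-1)^{i+1}\dfrac{\sqrt{[2i]}}{[2]\sqrt{[2i-1][2i+1]}}\sqrt{[2][2i]\mp[8n-4i]}, & i=n+1,\ldots,2n-1.\end{cases}$$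
   Context: Let $q=e^{\pi i/(4n)}$ and $[m]=(q^m-q^{-m})/(q-q^{-1})$. The graph $\mathcal{A}^{(4n)\ast}$ has vertices $1,\ldots,2n-1$, one edge $i\to i+1$ and one edge $i+1\to i$ for $1\le i\le 2n-2$, and one loop $i\to i$ at every vertex $i$. Its Perron-Frobenius eigenvector (eigenvalue $[3]$) is $\phi_i=[2i]/[2]$. $W_{a,b,c}$ denotes the value of $W$ on the triangle $a\to b\to c\to a$. Cell systems: let $\mathcal{G}$ be a directed graph (loops and multiple edges allowed), with source and range maps $s,r$, Perron-Frobenius eigenvalue $[3]$ and positive Perron-Frobenius eigenvector $(\phi_i)$. A triangle $\triangle_{ijk}^{(\alpha\beta\gamma)}$ is a closed path $i\xrightarrow{\alpha}j\xrightarrow{\beta}k\xrightarrow{\gamma}i$, considered up to cyclic rotation. A cell system $W$ assigns to each triangle a complex number $W(\triangle_{ijk}^{(\alpha\beta\gamma)})$ such that: (I) for all edges $\alpha,\alpha'$ from $i$ to $j$, $\sum_{k,\beta,\gamma}W(\triangle_{ijk}^{(\alpha\beta\gamma)})\overline{W(\triangle_{ijk}^{(\alpha'\beta\gamma)})}=\delta_{\alpha,\alpha'}[2]\phi_i\phi_j$, the sum being over vertices $k$ and edges $\beta:j\to k$, $\gamma:k\to i$; (II) for all edges $\alpha_1,\dots,\alpha_4$ with $s(\alpha_1)=s(\alpha_4)=i_1$, $r(\alpha_1)=r(\alpha_2)=i_2$, $s(\alpha_2)=s(\alpha_3)=i_3$, $r(\alpha_3)=r(\alpha_4)=i_4$,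 $$\sum\phi_k^{-1}W(\triangle_{i_1i_2k}^{(\alpha_1\beta_1\beta_2)})\overline{W(\triangle_{i_3i_2k}^{(\alpha_2\beta_1\beta_3)})}W(\triangle_{i_3i_4k}^{(\alpha_3\beta_4\beta_3)})\overline{W(\triangle_{i_1i_4k}^{(\alpha_4\beta_4\beta_2)})}=\delta_{\alpha_1,\alpha_4}\delta_{\alpha_2,\alpha_3}\phi_{i_1}\phi_{i_2}\phi_{i_3}+\delta_{\alpha_1,\alpha_2}\delta_{\alpha_3,\alpha_4}\phi_{i_1}\phi_{i_2}\phi_{i_4},$$ the sum being over vertices $k$ and edges $\beta_1:i_2\to k$, $\beta_2:k\to i_1$, $\beta_3:k\to i_3$, $\beta_4:i_4\to k$. Two cell systems $W_1,W_2$ on $\mathcal{G}$ are equivalent if for each pair of adjacent vertices $i,j$ there is a unitary matrix $(u(\sigma,\sigma'))$ indexed by the edges from $i$ to $j$ such that for every triangle $W_1(\triangle_{ijk}^{(\sigma\rho\gamma)})=\sum_{\sigma',\rho',\gamma'}u(\sigma,\sigma')u(\rho,\rho')u(\gamma,\gamma')W_2(\triangle_{ijk}^{(\sigma'\rho'\gamma')})$, summing over edges $\sigma':i\to j$, $\rho':j\to k$, $\gamma':k\to i$.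
   Formalization: The inequivalence of W^+ and W^- is claimed only for n ≥ 2, because for n = 1 the graph is a single vertex with one loop and the formulas give W^+ = W^-; all other claims are stated for every n ≥ 1. *)

theory Defs
  imports Complex_Main "Graph_Theory.Digraph"
begin

section \<open>Quantum integers\<close>

definition q_int :: "complex \<Rightarrow> int \<Rightarrow> complex" where
  "q_int q m = (q powi m - q powi (- m)) / (q - inverse q)"

definition q_root :: "nat \<Rightarrow> complex" where
  "q_root n = exp (complex_of_real pi * \<i> / (4 * of_nat n))"

text \<open>At the root of unity \<open>q_root n\<close> every quantum integer is real (lemma \<open>of_real_qn\<close>
  below), so passing to the real part loses nothing.\<close>

definition qn :: "nat \<Rightarrow> int \<Rightarrow> real" where
  "qn n m = Re (q_int (q_root n) m)"

lemma q_root_powi: "q_root n powi m = cis (of_int m * pi / (4 * real n))"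
proof -
  have "q_root n = cis (pi / (4 * real n))"
    by (simp add: q_root_def cis_conv_exp mult.commute)
  then show ?thesis
    by (simp add: cis_power_int)
qed

lemma q_int_q_root:
  "q_int (q_root n) m
     = complex_of_real (sin (of_int m * pi / (4 * real n)) / sin (pi / (4 * real n)))"
proof -
  have *: "cis x - cis (- x) = 2 * \<i> * complex_of_real (sin x)" for x
    by (simp add: complex_eq_iff)
  have "q_root n - inverse (q_root n) = q_root n powi 1 - q_root n powi (- 1)"
    by (simp add: power_int_minus)
  also have "\<dots> = 2 * \<i> * complex_of_real (sin (pi / (4 * real n)))"
    using *[of "pi / (4 * real n)"] by (simp only: q_root_powi) simp
  finally have "q_root n - inverse (q_root n) = \<dots>" .
  moreover have "q_root n powi m - q_root n powi (- m)
      = 2 * \<i> * complex_of_real (sin (of_int m * pi / (4 * real n)))"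
    using *[of "of_int m * pi / (4 * real n)"] by (simp only: q_root_powi) simp
  ultimately show ?thesis
    by (simp add: q_int_def)
qed

lemma qn_sin: "qn n m = sin (of_int m * pi / (4 * real n)) / sin (pi / (4 * real n))"
  by (simp only: qn_def q_int_q_root Re_complex_of_real)

lemma of_real_qn: "complex_of_real (qn n m) = q_int (q_root n) m"
  by (simp only: qn_sin q_int_q_root)


section \<open>Cell systems on a directed multigraph\<close>

definition edges :: "('v, 'e) pre_digraph \<Rightarrow> 'v \<Rightarrow> 'v \<Rightarrow> 'e set" where
  "edges G i j = {e \<in> arcs G. tail G e = i \<and> head G e = j}"

text \<open>A strictly positive eigenvector of a nonnegative matrix belongs to the spectral radius, so
  the two assumptions say that \<open>[3]\<close> is the Perron-Frobenius eigenvalue and \<open>\<phi>\<close> a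
  Perron-Frobenius eigenvector.\<close>

locale pf_digraph = fin_digraph G for G :: "('v, 'e) pre_digraph" +
  fixes q :: complex and \<phi> :: "'v \<Rightarrow> real"
  assumes phi_pos: "i \<in> verts G \<Longrightarrow> \<phi> i > 0"
    and phi_eigen: "i \<in> verts G \<Longrightarrow>
      (\<Sum>e \<in> {e \<in> arcs G. tail G e = i}. complex_of_real (\<phi> (head G e))) = q_int q 3 * \<phi> i"

text \<open>The triangle \<open>i \<rightarrow> j \<rightarrow> k \<rightarrow> i\<close> with edges \<open>\<alpha>\<close>, \<open>\<beta>\<close>, \<open>\<gamma>\<close> is represented by the
  triple of edges; \<open>W_rotate\<close> expresses that triangles are taken up to cyclic rotation. The values
  of \<open>W\<close> on triples of edges that do not form a triangle are irrelevant.\<close>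

locale cell_system = pf_digraph G q \<phi>
  for G :: "('v, 'e) pre_digraph" and q :: complex and \<phi> :: "'v \<Rightarrow> real" +
  fixes W :: "'e \<Rightarrow> 'e \<Rightarrow> 'e \<Rightarrow> complex"
  assumes W_rotate:
    "\<lbrakk>\<alpha> \<in> edges G i j; \<beta> \<in> edges G j k; \<gamma> \<in> edges G k i\<rbrakk> \<Longrightarrow> W \<beta> \<gamma> \<alpha> = W \<alpha> \<beta> \<gamma>"
  and type_I:
    "\<lbrakk>\<alpha> \<in> edges G i j; \<alpha>' \<in> edges G i j\<rbrakk> \<Longrightarrow>
      (\<Sum>k \<in> verts G. \<Sum>\<beta> \<in> edges G j k. \<Sum>\<gamma> \<in> edges G k i. W \<alpha> \<beta> \<gamma> * cnj (W \<alpha>' \<beta> \<gamma>))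
      = (if \<alpha> = \<alpha>' then q_int q 2 * \<phi> i * \<phi> j else 0)"
  and type_II:
    "\<lbrakk>\<alpha>1 \<in> edges G i1 i2; \<alpha>2 \<in> edges G i3 i2; \<alpha>3 \<in> edges G i3 i4; \<alpha>4 \<in> edges G i1 i4\<rbrakk> \<Longrightarrow>
      (\<Sum>k \<in> verts G. \<Sum>\<beta>1 \<in> edges G i2 k. \<Sum>\<beta>2 \<in> edges G k i1.
         \<Sum>\<beta>3 \<in> edges G k i3. \<Sum>\<beta>4 \<in> edges G i4 k.
           inverse (complex_of_real (\<phi> k)) * W \<alpha>1 \<beta>1 \<beta>2 * cnj (W \<alpha>2 \<beta>1 \<beta>3)
             * W \<alpha>3 \<beta>4 \<beta>3 * cnj (W \<alpha>4 \<beta>4 \<beta>2))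
      = (if \<alpha>1 = \<alpha>4 \<and> \<alpha>2 = \<alpha>3 then complex_of_real (\<phi> i1 * \<phi> i2 * \<phi> i3) else 0)
        + (if \<alpha>1 = \<alpha>2 \<and> \<alpha>3 = \<alpha>4 then complex_of_real (\<phi> i1 * \<phi> i2 * \<phi> i4) else 0)"

definition unitary_on :: "'e set \<Rightarrow> ('e \<Rightarrow> 'e \<Rightarrow> complex) \<Rightarrow> bool" where
  "unitary_on E u \<longleftrightarrow>
     (\<forall>\<sigma>\<in>E. \<forall>\<sigma>'\<in>E. (\<Sum>\<tau>\<in>E. u \<sigma> \<tau> * cnj (u \<sigma>' \<tau>)) = (if \<sigma> = \<sigma>' then 1 else 0)) \<and>
     (\<forall>\<sigma>\<in>E. \<forall>\<sigma>'\<in>E. (\<Sum>\<tau>\<in>E. cnj (u \<tau> \<sigma>) * u \<tau> \<sigma>') = (if \<sigma> = \<sigma>' then 1 else 0))"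

text \<open>Distinct ordered pairs \<open>(i, j)\<close> have disjoint edge sets, so one function \<open>u\<close> on pairs of
  edges encodes the whole family of unitary matrices, an independent one for each pair.\<close>

definition cell_equiv ::
  "('v, 'e) pre_digraph \<Rightarrow> ('e \<Rightarrow> 'e \<Rightarrow> 'e \<Rightarrow> complex) \<Rightarrow> ('e \<Rightarrow> 'e \<Rightarrow> 'e \<Rightarrow> complex) \<Rightarrow> bool" where
  "cell_equiv G W1 W2 \<longleftrightarrow>
     (\<exists>u. (\<forall>i \<in> verts G. \<forall>j \<in> verts G. unitary_on (edges G i j) u) \<and>
       (\<forall>i \<in> verts G. \<forall>j \<in> verts G. \<forall>k \<in> verts G.
        \<forall>\<sigma> \<in> edges G i j. \<forall>\<rho> \<in> edges G j k. \<forall>\<gamma> \<in> edges G k i.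
          W1 \<sigma> \<rho> \<gamma> = (\<Sum>\<sigma>' \<in> edges G i j. \<Sum>\<rho>' \<in> edges G j k. \<Sum>\<gamma>' \<in> edges G k i.
             u \<sigma> \<sigma>' * u \<rho> \<rho>' * u \<gamma> \<gamma>' * W2 \<sigma>' \<rho>' \<gamma>')))"


section \<open>The graph \<open>A\<^sup>(\<^sup>4\<^sup>n\<^sup>)\<^sup>*\<close> and its cells\<close>

definition A_star :: "nat \<Rightarrow> (nat, nat \<times> nat) pre_digraph" where
  "A_star n = \<lparr> verts = {1..2 * n - 1},
     arcs = {(i, i) | i. i \<in> {1..2 * n - 1}}
          \<union> {(i, i + 1) | i. i \<in> {1..2 * n - 2}}
          \<union> {(i + 1, i) | i. i \<in> {1..2 * n - 2}},
     tail = fst, head = snd \<rparr>"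

definition phi_star :: "nat \<Rightarrow> nat \<Rightarrow> real" where
  "phi_star n i = qn n (2 * int i) / qn n 2"

text \<open>In the following, \<open>\<epsilon> = 1\<close> gives the upper signs (the solution \<open>W\<^sup>+\<close>) and \<open>\<epsilon> = -1\<close> the
  lower signs (\<open>W\<^sup>-\<close>).\<close>

definition W_i_i_Si :: "nat \<Rightarrow> real \<Rightarrow> nat \<Rightarrow> real" where
  "W_i_i_Si n \<epsilon> i =
     sqrt (qn n (2 * int i) * qn n (2 * int i + 2)) / (qn n 2 * sqrt (qn n (2 * int i + 1)))
     * sqrt (qn n (2 * int i) - \<epsilon> * qn n 1)"

definition W_i_Si_Si :: "nat \<Rightarrow> real \<Rightarrow> nat \<Rightarrow> real" where
  "W_i_Si_Si n \<epsilon> i =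
     sqrt (qn n (2 * int i) * qn n (2 * int i + 2)) / (qn n 2 * sqrt (qn n (2 * int i + 1)))
     * sqrt (qn n (2 * int i + 2) + \<epsilon> * qn n 1)"

definition W_i_i_i :: "nat \<Rightarrow> real \<Rightarrow> nat \<Rightarrow> real" where
  "W_i_i_i n \<epsilon> i =
     (if i < n then
        (-1) ^ (i + 1) * (sqrt (qn n (2 * int i))
          / (qn n 2 * sqrt (qn n (2 * int i - 1) * qn n (2 * int i + 1))))
        * sqrt (qn n 2 * qn n (2 * int i) + \<epsilon> * qn n (4 * int i))
      else if i = n then
        (-1) ^ (n + 1) * (qn n (2 * int n)
          / sqrt (qn n 2 * qn n (2 * int n - 1) * qn n (2 * int n + 1)))
      else
        (-1) ^ (i + 1) * (sqrt (qn n (2 * int i))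
          / (qn n 2 * sqrt (qn n (2 * int i - 1) * qn n (2 * int i + 1))))
        * sqrt (qn n 2 * qn n (2 * int i) - \<epsilon> * qn n (8 * int n - 4 * int i)))"

text \<open>Every triangle \<open>a \<rightarrow> b \<rightarrow> c \<rightarrow> a\<close> of the graph is a rotation of \<open>(i, i, i)\<close>,
  \<open>(i, i, i + 1)\<close> or \<open>(i, i + 1, i + 1)\<close>, where \<open>i\<close> is its smallest vertex; the final \<open>0\<close> is
  never taken on triangles.\<close>

definition W_verts :: "nat \<Rightarrow> real \<Rightarrow> nat \<Rightarrow> nat \<Rightarrow> nat \<Rightarrow> real" where
  "W_verts n \<epsilon> a b c =
     (let i = min a (min b c) in
      if (a, b, c) = (i, i, i) then W_i_i_i n \<epsilon> i
      else if (a, b, c) \<in> {(i, i, i + 1), (i, i + 1, i), (i + 1, i, i)} then W_i_i_Si n \<epsilon> i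
      else if (a, b, c) \<in> {(i, i + 1, i + 1), (i + 1, i + 1, i), (i + 1, i, i + 1)}
        then W_i_Si_Si n \<epsilon> i
      else 0)"

definition W_pm ::
  "nat \<Rightarrow> real \<Rightarrow> nat \<times> nat \<Rightarrow> nat \<times> nat \<Rightarrow> nat \<times> nat \<Rightarrow> complex" where
  "W_pm n \<epsilon> \<alpha> \<beta> \<gamma> = complex_of_real (W_verts n \<epsilon> (fst \<alpha>) (fst \<beta>) (fst \<gamma>))"

definition W_plus :: "nat \<Rightarrow> nat \<times> nat \<Rightarrow> nat \<times> nat \<Rightarrow> nat \<times> nat \<Rightarrow> complex" where
  "W_plus n = W_pm n 1"

definition W_minus :: "nat \<Rightarrow> nat \<times> nat \<Rightarrow> nat \<times> nat \<Rightarrow> nat \<times> nat \<Rightarrow> complex" where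
  "W_minus n = W_pm n (- 1)"

text \<open>For \<open>n = 1\<close> the graph is a single vertex with a loop and the two solutions coincide.\<close>

lemma W_plus_eq_W_minus_1:
  assumes "\<alpha> \<in> arcs (A_star 1)" "\<beta> \<in> arcs (A_star 1)" "\<gamma> \<in> arcs (A_star 1)"
  shows "W_plus 1 \<alpha> \<beta> \<gamma> = W_minus 1 \<alpha> \<beta> \<gamma>"
proof -
  have "arcs (A_star 1) = {(1, 1)}"
    by (auto simp: A_star_def)
  with assms show ?thesis
    by (simp add: W_plus_def W_minus_def W_pm_def W_verts_def W_i_i_i_def)
qed

end

theory Submission
  imports Defs
begin

text \<open>Between two vertices of \<open>A\<^sup>(\<^sup>4\<^sup>n\<^sup>)\<^sup>*\<close> there is at most one edge in each direction, and every
  triangle is a rotation of \<open>(i, i, i)\<close>, \<open>(i, i, i + 1)\<close> or \<open>(i, i + 1, i + 1)\<close>. So a cell system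
  consists of three sequences of complex numbers \<open>A\<^sub>i\<close>, \<open>B\<^sub>i\<close>, \<open>C\<^sub>i\<close>, and each axiom is an equation
  with at most three terms.

  \<^bold>\<open>Uniqueness.\<close> Type I at the edge \<open>i \<rightarrow> i + 1\<close> fixes \<open>|B\<^sub>i|\<^sup>2 + |C\<^sub>i|\<^sup>2\<close>, type II at the square
  \<open>i, i + 1, i + 2, i + 1\<close> fixes \<open>|C\<^sub>i| |B\<^bsub>i+1\<^esub>|\<close>, and type I at a loop then fixes \<open>|A\<^sub>i|\<close>: all
  moduli follow from \<open>|B\<^sub>1|\<close>. The only phases that equivalence cannot change are those of
  \<open>A\<^sub>i C\<^sub>i\<^sup>3 / (A\<^bsub>i+1\<^esub> B\<^sub>i\<^sup>3)\<close>, and type II at the square \<open>i, i, i + 1, i + 1\<close> determines them. Hence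
  two cell systems with the same \<open>|B\<^sub>1|\<close> are equivalent (\<open>cell_system_rigid\<close>). Finally type II at the
  square \<open>1, 2, 1, 2\<close> is a second, quadratic equation for \<open>|B\<^sub>1|\<^sup>2\<close> and \<open>|C\<^sub>1|\<^sup>2\<close>, so \<open>|B\<^sub>1|\<close> has
  at most two values (\<open>cell_system_modulus_dichotomy\<close>). For \<open>n \<ge> 2\<close> the
  solutions \<open>W\<^sup>+\<close> and \<open>W\<^sup>-\<close> have different \<open>|B\<^sub>1|\<close>; therefore they realise both values, and they
  are inequivalent because equivalence preserves moduli. No root of the quadratic has to be
  computed. For \<open>n = 1\<close> there is no \<open>B\<^sub>1\<close>, and all cell systems are equivalent.

  \<^bold>\<open>Existence.\<close> Let \<open>\<theta> = \<pi> / 4n\<close>, and let \<open>t\<^sub>i\<close> be \<open>sin ((2i - 1) \<theta> / 2)\<close> for \<open>W\<^sup>+\<close> and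
  \<open>cos ((2i - 1) \<theta> / 2)\<close> for \<open>W\<^sup>-\<close>. Half-angle formulas turn the radicals into
  \<open>B\<^sub>i\<^sup>2 = \<phi>\<^sub>i \<phi>\<^bsub>i+1\<^esub> t\<^sub>i / t\<^bsub>i+1\<^esub>\<close>, \<open>C\<^sub>i\<^sup>2 = \<phi>\<^sub>i \<phi>\<^bsub>i+1\<^esub> t\<^bsub>i+2\<^esub> / t\<^bsub>i+1\<^esub>\<close> and
  \<open>A\<^sub>i\<^sup>2 = \<phi>\<^sub>i\<^sup>2 sin\<^sup>2 \<theta> / (t\<^sub>i t\<^bsub>i+1\<^esub>)\<close>. In this form the axioms follow for both signs at once from
  \<open>t\<^sub>i + t\<^bsub>i+2\<^esub> = [2] t\<^bsub>i+1\<^esub>\<close>, \<open>t\<^sub>i t\<^bsub>i+2\<^esub> + sin\<^sup>2 \<theta> = t\<^bsub>i+1\<^esub>\<^sup>2\<close> and two trigonometric identities that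
  relate \<open>t\<close> to \<open>\<phi>\<close>. The ends of the path need no separate treatment, since
  \<open>\<phi>\<^sub>0 = \<phi>\<^bsub>2n\<^esub> = 0\<close> makes the missing cells vanish.\<close>

section \<open>The axioms on a path with loops\<close>

definition nbr :: "nat \<Rightarrow> nat \<Rightarrow> nat \<Rightarrow> bool" where
  "nbr n i j \<longleftrightarrow> 1 \<le> i \<and> i < 2 * n \<and> 1 \<le> j \<and> j < 2 * n \<and> (i = j \<or> j = Suc i \<or> i = Suc j)"

text \<open>The range of the sums in the axioms depends on the set of corners only, not on their order or
  multiplicity.\<close>

definition common_nbrs :: "nat \<Rightarrow> nat set \<Rightarrow> nat set" where
  "common_nbrs n S = {k. \<forall>i\<in>S. nbr n i k}"

text \<open>There is at most one edge from one vertex to another, so the vertices determine the triangle.\<close>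

definition tri :: "(nat \<times> nat \<Rightarrow> nat \<times> nat \<Rightarrow> nat \<times> nat \<Rightarrow> complex) \<Rightarrow> nat \<Rightarrow> nat \<Rightarrow> nat \<Rightarrow> complex" where
  "tri W a b c = W (a, b) (b, c) (c, a)"

lemma nbr_sym: "nbr n i j \<longleftrightarrow> nbr n j i"
  by (auto simp: nbr_def)

lemma edges_A_star: "edges (A_star n) i j = (if nbr n i j then {(i, j)} else {})"
  by (auto simp: edges_def A_star_def nbr_def)

lemma sum_edges_A_star:
  "(\<Sum>\<beta>\<in>edges (A_star n) i j. f \<beta>) = (if nbr n i j then f (i, j) else 0)"
  by (simp add: edges_A_star)

lemma sum_verts_common_nbrs:
  assumes "\<And>k. P k \<longleftrightarrow> (\<forall>i\<in>S. nbr n i k)" and "S \<noteq> {}"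
  shows "(\<Sum>k\<in>verts (A_star n). if P k then f k else 0) = (\<Sum>k\<in>common_nbrs n S. f k)"
proof -
  have "common_nbrs n S = {k \<in> verts (A_star n). P k}"
    using assms by (auto simp: common_nbrs_def A_star_def nbr_def)
  then show ?thesis
    by (simp add: sum.inter_filter[symmetric] A_star_def)
qed

lemma type_I_sum_A_star:
  "(\<Sum>k\<in>verts (A_star n). \<Sum>\<beta>\<in>edges (A_star n) j k. \<Sum>\<gamma>\<in>edges (A_star n) k i.
      W (i, j) \<beta> \<gamma> * cnj (W (i, j) \<beta> \<gamma>))
   = (\<Sum>k\<in>common_nbrs n {i, j}. tri W i j k * cnj (tri W i j k))"
  (is "?L = ?R")
proof -
  have "?L = (\<Sum>k\<in>verts (A_star n). if nbr n j k \<and> nbr n k i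
               then tri W i j k * cnj (tri W i j k) else 0)"
    by (intro sum.cong refl) (auto simp: sum_edges_A_star tri_def)
  also have "\<dots> = ?R"
    by (rule sum_verts_common_nbrs) (auto simp: nbr_sym)
  finally show ?thesis .
qed

lemma type_II_sum_A_star:
  "(\<Sum>k\<in>verts (A_star n). \<Sum>\<beta>1\<in>edges (A_star n) i2 k. \<Sum>\<beta>2\<in>edges (A_star n) k i1.
     \<Sum>\<beta>3\<in>edges (A_star n) k i3. \<Sum>\<beta>4\<in>edges (A_star n) i4 k.
       inverse (complex_of_real (\<phi> k)) * W (i1, i2) \<beta>1 \<beta>2 * cnj (W (i3, i2) \<beta>1 \<beta>3)
         * W (i3, i4) \<beta>4 \<beta>3 * cnj (W (i1, i4) \<beta>4 \<beta>2))
   = (\<Sum>k\<in>common_nbrs n {i1, i2, i3, i4}. inverse (complex_of_real (\<phi> k))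
       * tri W i1 i2 k * cnj (tri W i3 i2 k) * tri W i3 i4 k * cnj (tri W i1 i4 k))"
  (is "?L = ?R")
proof -
  have "?L = (\<Sum>k\<in>verts (A_star n).
      if nbr n i2 k \<and> nbr n k i1 \<and> nbr n k i3 \<and> nbr n i4 k
      then inverse (complex_of_real (\<phi> k))
       * tri W i1 i2 k * cnj (tri W i3 i2 k) * tri W i3 i4 k * cnj (tri W i1 i4 k) else 0)"
    by (intro sum.cong refl) (auto simp: sum_edges_A_star tri_def)
  also have "\<dots> = ?R"
    by (rule sum_verts_common_nbrs) (auto simp: nbr_sym)
  finally show ?thesis .
qed

text \<open>The axioms with every sum over edges collapsed: all four sides of a square and all the spokes
  from its corners to \<open>k\<close> exist for exactly the common neighbours \<open>k\<close> of the corners.\<close>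

lemma cell_system_A_star_iff:
  "cell_system (A_star n) q \<phi> W \<longleftrightarrow>
     pf_digraph (A_star n) q \<phi> \<and>
     (\<forall>a b c. nbr n a b \<longrightarrow> nbr n b c \<longrightarrow> nbr n c a \<longrightarrow> tri W b c a = tri W a b c) \<and>
     (\<forall>i j. nbr n i j \<longrightarrow>
        (\<Sum>k\<in>common_nbrs n {i, j}. tri W i j k * cnj (tri W i j k)) = q_int q 2 * \<phi> i * \<phi> j) \<and>
     (\<forall>i1 i2 i3 i4. nbr n i1 i2 \<longrightarrow> nbr n i3 i2 \<longrightarrow> nbr n i3 i4 \<longrightarrow> nbr n i1 i4 \<longrightarrow>
        (\<Sum>k\<in>common_nbrs n {i1, i2, i3, i4}. inverse (complex_of_real (\<phi> k))
           * tri W i1 i2 k * cnj (tri W i3 i2 k) * tri W i3 i4 k * cnj (tri W i1 i4 k))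
        = (if i2 = i4 then complex_of_real (\<phi> i1 * \<phi> i2 * \<phi> i3) else 0)
          + (if i1 = i3 then complex_of_real (\<phi> i1 * \<phi> i2 * \<phi> i4) else 0))"
  (is "?cs \<longleftrightarrow> ?pf \<and> ?rot \<and> ?I \<and> ?II")
proof
  assume ?cs
  then interpret cell_system "A_star n" q \<phi> W .
  have edge: "(i, j) \<in> edges (A_star n) i j" if "nbr n i j" for i j
    using that by (simp add: edges_A_star)
  have ?rot
    unfolding tri_def by (intro allI impI) (rule W_rotate[OF edge edge edge])
  moreover have ?I
  proof (intro allI impI)
    fix i j
    assume "nbr n i j"
    from type_I[OF edge[OF this] edge[OF this], unfolded type_I_sum_A_star]
    show "(\<Sum>k\<in>common_nbrs n {i, j}. tri W i j k * cnj (tri W i j k)) = q_int q 2 * \<phi> i * \<phi> j"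
      by simp
  qed
  moreover have ?II
  proof (intro allI impI)
    fix i1 i2 i3 i4
    assume "nbr n i1 i2" "nbr n i3 i2" "nbr n i3 i4" "nbr n i1 i4"
    from type_II[OF this[THEN edge], unfolded type_II_sum_A_star prod.inject]
    show "(\<Sum>k\<in>common_nbrs n {i1, i2, i3, i4}. inverse (complex_of_real (\<phi> k))
           * tri W i1 i2 k * cnj (tri W i3 i2 k) * tri W i3 i4 k * cnj (tri W i1 i4 k))
        = (if i2 = i4 then complex_of_real (\<phi> i1 * \<phi> i2 * \<phi> i3) else 0)
          + (if i1 = i3 then complex_of_real (\<phi> i1 * \<phi> i2 * \<phi> i4) else 0)"
      by simp
  qed
  moreover have ?pf
    by unfold_locales
  ultimately show "?pf \<and> ?rot \<and> ?I \<and> ?II"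
    by (intro conjI)
next
  assume r: "?pf \<and> ?rot \<and> ?I \<and> ?II"
  note pf = r[THEN conjunct1] and rot = r[THEN conjunct2, THEN conjunct1]
    and I = r[THEN conjunct2, THEN conjunct2, THEN conjunct1]
    and II = r[THEN conjunct2, THEN conjunct2, THEN conjunct2]
  have edgeE: "\<alpha> = (i, j) \<and> nbr n i j" if "\<alpha> \<in> edges (A_star n) i j" for \<alpha> i j
    using that by (auto simp: edges_A_star split: if_splits)
  interpret pf_digraph "A_star n" q \<phi>
    by (fact pf)
  show ?cs
  proof unfold_locales
    fix \<alpha> i j \<beta> k \<gamma>
    assume *: "\<alpha> \<in> edges (A_star n) i j" "\<beta> \<in> edges (A_star n) j k" "\<gamma> \<in> edges (A_star n) k i"
    show "W \<beta> \<gamma> \<alpha> = W \<alpha> \<beta> \<gamma>"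
      using *[THEN edgeE] rot[rule_format, of i j k] by (simp add: tri_def)
  next
    fix \<alpha> i j \<alpha>'
    assume *: "\<alpha> \<in> edges (A_star n) i j" "\<alpha>' \<in> edges (A_star n) i j"
    show "(\<Sum>k\<in>verts (A_star n). \<Sum>\<beta>\<in>edges (A_star n) j k. \<Sum>\<gamma>\<in>edges (A_star n) k i.
             W \<alpha> \<beta> \<gamma> * cnj (W \<alpha>' \<beta> \<gamma>)) = (if \<alpha> = \<alpha>' then q_int q 2 * \<phi> i * \<phi> j else 0)"
    proof -
      have \<alpha>: "\<alpha> = (i, j)" "\<alpha>' = (i, j)" and nbr: "nbr n i j"
        using *[THEN edgeE] by blast+
      show ?thesis
        unfolding \<alpha> type_I_sum_A_star I[rule_format, OF nbr] by simp
    qed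
  next
    fix \<alpha>1 i1 i2 \<alpha>2 i3 \<alpha>3 i4 \<alpha>4
    assume *: "\<alpha>1 \<in> edges (A_star n) i1 i2" "\<alpha>2 \<in> edges (A_star n) i3 i2"
      "\<alpha>3 \<in> edges (A_star n) i3 i4" "\<alpha>4 \<in> edges (A_star n) i1 i4"
    show "(\<Sum>k\<in>verts (A_star n). \<Sum>\<beta>1\<in>edges (A_star n) i2 k. \<Sum>\<beta>2\<in>edges (A_star n) k i1.
     \<Sum>\<beta>3\<in>edges (A_star n) k i3. \<Sum>\<beta>4\<in>edges (A_star n) i4 k.
       inverse (complex_of_real (\<phi> k)) * W \<alpha>1 \<beta>1 \<beta>2 * cnj (W \<alpha>2 \<beta>1 \<beta>3)
         * W \<alpha>3 \<beta>4 \<beta>3 * cnj (W \<alpha>4 \<beta>4 \<beta>2))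
      = (if \<alpha>1 = \<alpha>4 \<and> \<alpha>2 = \<alpha>3 then complex_of_real (\<phi> i1 * \<phi> i2 * \<phi> i3) else 0)
        + (if \<alpha>1 = \<alpha>2 \<and> \<alpha>3 = \<alpha>4 then complex_of_real (\<phi> i1 * \<phi> i2 * \<phi> i4) else 0)"
    proof -
      have \<alpha>: "\<alpha>1 = (i1, i2)" "\<alpha>2 = (i3, i2)" "\<alpha>3 = (i3, i4)" "\<alpha>4 = (i1, i4)"
        and nbrs: "nbr n i1 i2" "nbr n i3 i2" "nbr n i3 i4" "nbr n i1 i4"
        using *[THEN edgeE] by blast+
      show ?thesis
        unfolding \<alpha>
        by (rule trans[OF type_II_sum_A_star], rule trans[OF II[rule_format, OF nbrs]])
          (simp only: prod.inject simp_thms eq_commute[of i3 i1])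
    qed
  qed
qed

lemma common_nbrs_edge:
  assumes "1 \<le> j" "Suc j < 2 * n"
  shows "common_nbrs n {j, Suc j} = {j, Suc j}"
  using assms by (auto simp: common_nbrs_def nbr_def)

lemma common_nbrs_path:
  assumes "1 \<le> j" "Suc (Suc j) < 2 * n"
  shows "common_nbrs n {j, Suc j, Suc (Suc j)} = {Suc j}"
  using assms by (auto simp: common_nbrs_def nbr_def)

text \<open>At an end of the path one neighbour is missing. A summand that vanishes at the virtual vertices
  \<open>0\<close> and \<open>2 * n\<close> makes the end vertices look like inner ones.\<close>

lemma sum_common_nbrs_vertex:
  fixes f :: "nat \<Rightarrow> 'a::comm_monoid_add"
  assumes "j < 2 * n - 1" and "j = 0 \<Longrightarrow> f 0 = 0" and "Suc (Suc j) = 2 * n \<Longrightarrow> f (2 * n) = 0"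
  shows "(\<Sum>k\<in>common_nbrs n {Suc j}. f k) = f j + f (Suc j) + f (Suc (Suc j))"
proof -
  have "(\<Sum>k\<in>common_nbrs n {Suc j}. f k) = (\<Sum>k\<in>{j, Suc j, Suc (Suc j)}. f k)"
  proof (intro sum.mono_neutral_left ballI)
    fix k
    assume "k \<in> {j, Suc j, Suc (Suc j)} - common_nbrs n {Suc j}"
    then have "k = j \<and> j = 0 \<or> k = Suc (Suc j) \<and> Suc (Suc j) = 2 * n"
      using assms(1) by (auto simp: common_nbrs_def nbr_def)
    then show "f k = 0"
      using assms(2,3) by auto
  qed (use assms(1) in \<open>auto simp: common_nbrs_def nbr_def\<close>)
  then show ?thesis
    by (simp add: ac_simps)
qed

lemma triangle_cases:
  assumes "nbr n i j" "nbr n j k" "nbr n k i"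
  obtains (loop) "j = i" "k = i" "1 \<le> i" "i < 2 * n"
  | (edge) l where "1 \<le> l" "Suc l < 2 * n"
      "(i, j, k) \<in> {(l, l, Suc l), (l, Suc l, l), (Suc l, l, l),
         (l, Suc l, Suc l), (Suc l, l, Suc l), (Suc l, Suc l, l)}"
  using assms by (auto simp: nbr_def)

text \<open>A closed walk of length four on a path with loops spans at most three vertices; when it spans
  three, two opposite corners are the middle one.\<close>

lemma square_cases:
  assumes "nbr n i1 i2" "nbr n i3 i2" "nbr n i3 i4" "nbr n i1 i4"
  obtains (vertex) l where "l < 2 * n - 1" "i1 = Suc l" "i2 = Suc l" "i3 = Suc l" "i4 = Suc l"
  | (edge) l where "1 \<le> l" "Suc l < 2 * n" "{i1, i2, i3, i4} = {l, Suc l}"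
  | (path) l where "1 \<le> l" "Suc (Suc l) < 2 * n"
      "i2 = Suc l \<and> i4 = Suc l \<and> {i1, i3} = {l, Suc (Suc l)}
       \<or> i1 = Suc l \<and> i3 = Suc l \<and> {i2, i4} = {l, Suc (Suc l)}"
proof -
  \<comment> \<open>The smallest corner says which of the three shapes occurs and where.\<close>
  define m where "m = min (min i1 i2) (min i3 i4)"
  have m: "m \<in> {i1, i2, i3, i4}" "m \<le> i1" "m \<le> i2" "m \<le> i3" "m \<le> i4"
    unfolding m_def by (auto simp: min_def)
  have b: "1 \<le> m" "\<forall>i\<in>{i1, i2, i3, i4}. i < 2 * n"
    using m(1) assms by (auto simp: nbr_def)
  consider "{i1, i2, i3, i4} = {m}" | "{i1, i2, i3, i4} = {m, Suc m}" 
    | "i2 = Suc m \<and> i4 = Suc m \<and> {i1, i3} = {m, Suc (Suc m)}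
       \<or> i1 = Suc m \<and> i3 = Suc m \<and> {i2, i4} = {m, Suc (Suc m)}"
    using assms m unfolding nbr_def by auto
  then show thesis
  proof cases
    case 1
    then show thesis
      using vertex[of "m - 1"] b by auto
  next
    case 2
    have "Suc m \<in> {i1, i2, i3, i4}"
      using 2 by simp
    then show thesis
      using edge[of m] 2 b by auto
  next
    case 3
    then have "Suc (Suc m) \<in> {i1, i2, i3, i4}"
      by auto
    then show thesis
      using path[of m] 3 b by auto
  qed
qed

lemma pf_digraph_A_starI:
  assumes "\<And>i. 1 \<le> i \<Longrightarrow> i < 2 * n \<Longrightarrow> \<phi> i > 0" "\<phi> 0 = 0" "\<phi> (2 * n) = 0"
    and "\<And>i. Suc i < 2 * n \<Longrightarrow> complex_of_real (\<phi> i + \<phi> (Suc i) + \<phi> (Suc (Suc i))) = q_int q 3 * \<phi> (Suc i)"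
  shows "pf_digraph (A_star n) q \<phi>"
proof unfold_locales
  show "finite (verts (A_star n))"
    by (simp add: A_star_def)
  have arcs: "arcs (A_star n) = {(i, j). nbr n i j}"
    by (auto simp: A_star_def nbr_def)
  have "arcs (A_star n) \<subseteq> {..2 * n} \<times> {..2 * n}"
    unfolding arcs by (auto simp: nbr_def)
  then show "finite (arcs (A_star n))"
    by (rule finite_subset) simp
  show "tail (A_star n) e \<in> verts (A_star n)" "head (A_star n) e \<in> verts (A_star n)"
    if "e \<in> arcs (A_star n)" for e
    using that unfolding arcs by (auto simp: A_star_def nbr_def)
  show "\<phi> i > 0" if "i \<in> verts (A_star n)" for i
    using that assms(1) by (auto simp: A_star_def)
  show "(\<Sum>e\<in>{e \<in> arcs (A_star n). tail (A_star n) e = i}. complex_of_real (\<phi> (head (A_star n) e)))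
      = q_int q 3 * \<phi> i" if "i \<in> verts (A_star n)" for i
  proof -
    have "{e \<in> arcs (A_star n). tail (A_star n) e = i} = Pair i ` common_nbrs n {i}"
      unfolding arcs by (auto simp: A_star_def common_nbrs_def)
    then have "(\<Sum>e\<in>{e \<in> arcs (A_star n). tail (A_star n) e = i}. complex_of_real (\<phi> (head (A_star n) e)))
        = (\<Sum>k\<in>common_nbrs n {i}. complex_of_real (\<phi> k))"
      by (simp add: sum.reindex inj_on_def A_star_def)
    also obtain j where j: "i = Suc j" "Suc j < 2 * n"
      using \<open>i \<in> verts (A_star n)\<close> by (cases i) (auto simp: A_star_def)
    have "(\<Sum>k\<in>common_nbrs n {i}. complex_of_real (\<phi> k)) = complex_of_real (\<phi> j + \<phi> (Suc j) + \<phi> (Suc (Suc j)))"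
      using j assms(2,3) by (simp add: sum_common_nbrs_vertex)
    also have "\<dots> = q_int q 3 * \<phi> i"
      using assms(4)[OF j(2)] j(1) by simp
    finally show ?thesis .
  qed
qed

section \<open>Moduli, phases and uniqueness\<close>

lemma cnj_sq: "z * cnj z = complex_of_real ((cmod z)\<^sup>2)"
  by (simp only: complex_mult_cnj cmod_power2)

locale A_star_cells = cell_system "A_star n" q \<phi> W
  for n :: nat and q :: complex and \<phi> :: "nat \<Rightarrow> real"
    and W :: "nat \<times> nat \<Rightarrow> nat \<times> nat \<Rightarrow> nat \<times> nat \<Rightarrow> complex"
begin

abbreviation "A i \<equiv> tri W i i i"
abbreviation "B i \<equiv> tri W i i (Suc i)"
abbreviation "C i \<equiv> tri W i (Suc i) (Suc i)"

lemma phi_gt_0: "1 \<le> i \<Longrightarrow> i < 2 * n \<Longrightarrow> \<phi> i > 0"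
  by (rule phi_pos) (auto simp: A_star_def)

lemma rotate: "nbr n a b \<Longrightarrow> nbr n b c \<Longrightarrow> nbr n c a \<Longrightarrow> tri W b c a = tri W a b c"
  using cell_system_axioms unfolding cell_system_A_star_iff by blast

lemma cells_I: "nbr n i j \<Longrightarrow>
    (\<Sum>k\<in>common_nbrs n {i, j}. tri W i j k * cnj (tri W i j k)) = q_int q 2 * \<phi> i * \<phi> j"
  using cell_system_axioms unfolding cell_system_A_star_iff by blast

lemma cells_II: "nbr n i1 i2 \<Longrightarrow> nbr n i3 i2 \<Longrightarrow> nbr n i3 i4 \<Longrightarrow> nbr n i1 i4 \<Longrightarrow>
    (\<Sum>k\<in>common_nbrs n {i1, i2, i3, i4}. inverse (complex_of_real (\<phi> k))
       * tri W i1 i2 k * cnj (tri W i3 i2 k) * tri W i3 i4 k * cnj (tri W i1 i4 k))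
    = (if i2 = i4 then complex_of_real (\<phi> i1 * \<phi> i2 * \<phi> i3) else 0)
      + (if i1 = i3 then complex_of_real (\<phi> i1 * \<phi> i2 * \<phi> i4) else 0)"
  using cell_system_axioms unfolding cell_system_A_star_iff by blast

text \<open>On two vertices every ordering of a triangle is a cyclic rotation of every other, so \<open>A\<close>, \<open>B\<close>
  and \<open>C\<close> carry all the information in \<open>W\<close>.\<close>

lemma tri_rotations:
  assumes "1 \<le> i" "Suc i < 2 * n"
  shows "tri W i (Suc i) i = B i" "tri W (Suc i) i i = B i"
    "tri W (Suc i) (Suc i) i = C i" "tri W (Suc i) i (Suc i) = C i"
  using assms rotate[of i i "Suc i"] rotate[of i "Suc i" i] rotate[of i "Suc i" "Suc i"]
    rotate[of "Suc i" "Suc i" i]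
  by (auto simp: nbr_def)

context
  fixes i :: nat
  assumes i: "1 \<le> i" "Suc i < 2 * n"
begin

lemma edge_I: "complex_of_real ((cmod (B i))\<^sup>2 + (cmod (C i))\<^sup>2) = q_int q 2 * \<phi> i * \<phi> (Suc i)"
  using cells_I[of i "Suc i"] i
  by (simp add: nbr_def common_nbrs_edge tri_rotations cnj_sq)

text \<open>This is the square \<open>i, i + 1, i, i + 1\<close>. Together with \<open>edge_I\<close> it is a quadratic
  equation for \<open>(cmod (B i))\<^sup>2\<close>.\<close>

lemma edge_II: "((cmod (B i))\<^sup>2)\<^sup>2 / \<phi> i + ((cmod (C i))\<^sup>2)\<^sup>2 / \<phi> (Suc i)
    = \<phi> i * \<phi> (Suc i) * (\<phi> i + \<phi> (Suc i))"
proof -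
  have "complex_of_real (((cmod (B i))\<^sup>2)\<^sup>2 / \<phi> i + ((cmod (C i))\<^sup>2)\<^sup>2 / \<phi> (Suc i))
      = inverse (\<phi> i) * (B i * cnj (B i)) * (B i * cnj (B i))
        + inverse (\<phi> (Suc i)) * (C i * cnj (C i)) * (C i * cnj (C i))"
    by (simp only: cnj_sq) (simp add: power2_eq_square divide_inverse ac_simps)
  also have "\<dots> = complex_of_real (\<phi> i * \<phi> (Suc i) * (\<phi> i + \<phi> (Suc i)))"
    using cells_II[of i "Suc i" i "Suc i"] i
    by (simp add: nbr_def common_nbrs_edge tri_rotations insert_commute algebra_simps)
  finally show ?thesis
    by (simp only: of_real_eq_iff)
qed

text \<open>The square \<open>i, i, i + 1, i + 1\<close> has no equal opposite corners, so its sum vanishes. This is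
  the only kind of square whose equation sees phases: it ties the phase of \<open>A (i + 1)\<close> to those of
  \<open>A i\<close>, \<open>B i\<close> and \<open>C i\<close>.\<close>

lemma phase_II: "A i * C i * (cnj (B i))\<^sup>2 / \<phi> i + B i * A (Suc i) * (cnj (C i))\<^sup>2 / \<phi> (Suc i) = 0"
proof -
  have "(\<Sum>k\<in>{i, Suc i}. inverse (complex_of_real (\<phi> k))
     * tri W i i k * cnj (tri W (Suc i) i k) * tri W (Suc i) (Suc i) k * cnj (tri W i (Suc i) k)) = 0"
    using cells_II[of i i "Suc i" "Suc i"] i
    by (simp add: nbr_def common_nbrs_edge)
  then have "inverse (complex_of_real (\<phi> i)) * A i * cnj (B i) * C i * cnj (B i)
     + inverse (complex_of_real (\<phi> (Suc i))) * B i * cnj (C i) * A (Suc i) * cnj (C i) = 0"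
    using i by (simp add: tri_rotations)
  moreover have "A i * C i * (cnj (B i))\<^sup>2 / \<phi> i = inverse (complex_of_real (\<phi> i)) * A i * cnj (B i) * C i * cnj (B i)"
    by (simp add: power2_eq_square divide_inverse)
  moreover have "B i * A (Suc i) * (cnj (C i))\<^sup>2 / \<phi> (Suc i)
      = inverse (complex_of_real (\<phi> (Suc i))) * B i * cnj (C i) * A (Suc i) * cnj (C i)"
    by (simp add: power2_eq_square divide_inverse)
  ultimately show ?thesis
    by (simp only:)
qed

text \<open>The square \<open>i, i + 1, i + 2, i + 1\<close> has only one common neighbour, which lets the moduli
  propagate from one edge to the next.\<close>

lemma path_II:
  assumes "Suc (Suc i) < 2 * n"
  shows "(cmod (C i))\<^sup>2 * (cmod (B (Suc i)))\<^sup>2 = \<phi> i * (\<phi> (Suc i))\<^sup>2 * \<phi> (Suc (Suc i))"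
proof -
  have "\<phi> (Suc i) > 0"
    using i by (simp add: phi_gt_0)
  have "complex_of_real ((cmod (C i))\<^sup>2 * (cmod (B (Suc i)))\<^sup>2) = (C i * cnj (C i)) * (B (Suc i) * cnj (B (Suc i)))"
    by (simp only: cnj_sq of_real_mult)
  also have "\<dots> = \<phi> (Suc i) * complex_of_real (\<phi> i * \<phi> (Suc i) * \<phi> (Suc (Suc i)))"
  proof -
    have "{i, Suc i, Suc (Suc i), Suc i} = {i, Suc i, Suc (Suc i)}"
      by auto
    then have "inverse (complex_of_real (\<phi> (Suc i))) * C i * cnj (B (Suc i)) * B (Suc i) * cnj (C i)
        = complex_of_real (\<phi> i * \<phi> (Suc i) * \<phi> (Suc (Suc i)))"
      using cells_II[of i "Suc i" "Suc (Suc i)" "Suc i"] i assms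
        common_nbrs_path[of i n] tri_rotations[of "Suc i"]
      by (simp add: nbr_def)
    then show ?thesis
      using \<open>\<phi> (Suc i) > 0\<close> by (simp add: field_simps)
  qed
  also have "\<dots> = complex_of_real (\<phi> i * (\<phi> (Suc i))\<^sup>2 * \<phi> (Suc (Suc i)))"
    by (simp add: power2_eq_square)
  finally show ?thesis
    by (simp only: of_real_eq_iff)
qed

end

end

lemma unimodular_cube_root:
  assumes "cmod z = 1"
  obtains w where "w ^ 3 = z" "cmod w = 1"
proof
  show "cis (Arg z / 3) ^ 3 = z"
    using assms rcis_cmod_Arg[of z] by (simp add: DeMoivre rcis_def)
qed simp

text \<open>A line meets an ellipse in at most two points.\<close>

lemma weighted_square_sum_two_solutions:
  fixes p r :: real
  assumes "p > 0" "r > 0"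
    and "x + y = m" "x' + y' = m" "x'' + y'' = m"
    and "p * x\<^sup>2 + r * y\<^sup>2 = s" "p * x'\<^sup>2 + r * y'\<^sup>2 = s" "p * x''\<^sup>2 + r * y''\<^sup>2 = s"
    and "x' \<noteq> x''"
  shows "x = x' \<or> x = x''"
proof (rule ccontr)
  assume neg: "\<not> ?thesis"
  have y: "y = m - x" "y' = m - x'" "y'' = m - x''"
    using assms by auto
  have factor: "(v - w) * ((p + r) * (v + w) - 2 * r * m)
      = (p * v\<^sup>2 + r * (m - v)\<^sup>2) - (p * w\<^sup>2 + r * (m - w)\<^sup>2)" for v w
    by (simp add: power2_eq_square algebra_simps)
  have "(x - x') * ((p + r) * (x + x') - 2 * r * m) = 0"
    unfolding factor using assms(6,7) unfolding y by simp
  moreover have "(x'' - x') * ((p + r) * (x'' + x') - 2 * r * m) = 0"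
    unfolding factor using assms(7,8) unfolding y by simp
  ultimately have "(p + r) * (x + x') = 2 * r * m" "(p + r) * (x'' + x') = 2 * r * m"
    using neg assms(9) by auto
  then have "(p + r) * (x - x'') = 0"
    by (simp add: algebra_simps)
  then show False
    using neg assms(1,2) by simp
qed

text \<open>Two known solutions with different moduli take the place of the explicit roots of the quadratic
  equation.\<close>

lemma cell_system_modulus_dichotomy:
  assumes "cell_system (A_star n) q \<phi> W" "cell_system (A_star n) q \<phi> W1" "cell_system (A_star n) q \<phi> W2"
    and i: "1 \<le> i" "Suc i < 2 * n"
    and ne: "cmod (tri W1 i i (Suc i)) \<noteq> cmod (tri W2 i i (Suc i))"
  shows "cmod (tri W i i (Suc i)) = cmod (tri W1 i i (Suc i))
    \<or> cmod (tri W i i (Suc i)) = cmod (tri W2 i i (Suc i))"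
proof -
  interpret X: A_star_cells n q \<phi> W by (rule A_star_cells.intro) (fact assms)
  interpret Y: A_star_cells n q \<phi> W1 by (rule A_star_cells.intro) (fact assms)
  interpret Z: A_star_cells n q \<phi> W2 by (rule A_star_cells.intro) (fact assms)
  have pos: "1 / \<phi> i > 0" "1 / \<phi> (Suc i) > 0"
    using i by (simp_all add: X.phi_gt_0)
  have sum: "(cmod (X.B i))\<^sup>2 + (cmod (X.C i))\<^sup>2 = (cmod (Y.B i))\<^sup>2 + (cmod (Y.C i))\<^sup>2"
    "(cmod (Z.B i))\<^sup>2 + (cmod (Z.C i))\<^sup>2 = (cmod (Y.B i))\<^sup>2 + (cmod (Y.C i))\<^sup>2"
    using X.edge_I[OF i] Y.edge_I[OF i] Z.edge_I[OF i] by (metis of_real_eq_iff)+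
  have "(cmod (X.B i))\<^sup>2 = (cmod (Y.B i))\<^sup>2 \<or> (cmod (X.B i))\<^sup>2 = (cmod (Z.B i))\<^sup>2"
    using X.edge_II[OF i] Y.edge_II[OF i] Z.edge_II[OF i] ne
    by (intro weighted_square_sum_two_solutions[OF pos sum(1) refl sum(2)]) auto
  then show ?thesis
    by simp
qed

text \<open>One modulus at the end of the path determines a cell system up to equivalence. For the moduli,
  \<open>edge_I\<close> passes from \<open>B i\<close> to \<open>C i\<close>, \<open>path_II\<close> from \<open>C i\<close> to \<open>B (i + 1)\<close>, and the type I
  equation of a loop gives \<open>A i\<close>. For the phases, a change of gauge multiplies \<open>A i\<close>, \<open>B i\<close>,
  \<open>C i\<close> by \<open>u\<^sub>i\<^sup>3\<close>, \<open>u\<^sub>i v\<^sub>i\<close>, \<open>u\<^bsub>i+1\<^esub> v\<^sub>i\<close>, where \<open>u\<^sub>i\<close> is the factor of the loop at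
  \<open>i\<close> and \<open>v\<^sub>i\<close> the product of the factors of the two edges between \<open>i\<close> and \<open>i + 1\<close>. A cube
  root fixes \<open>u\<^sub>1\<close>, the phases of \<open>B\<close> and \<open>C\<close> then fix all \<open>v\<^sub>i\<close> and \<open>u\<^bsub>i+1\<^esub>\<close>, and
  \<open>phase_II\<close> is what makes the phases of \<open>A\<close> agree with this choice.\<close>

lemma cell_system_rigid:
  assumes "cell_system (A_star n) q \<phi> W" "cell_system (A_star n) q \<phi> W'"
    and n: "n \<ge> 1"
    and A0: "\<And>i. 1 \<le> i \<Longrightarrow> i < 2 * n \<Longrightarrow> tri W' i i i \<noteq> 0"
    and B0: "\<And>i. 1 \<le> i \<Longrightarrow> Suc i < 2 * n \<Longrightarrow> tri W' i i (Suc i) \<noteq> 0"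
    and C0: "\<And>i. 1 \<le> i \<Longrightarrow> Suc i < 2 * n \<Longrightarrow> tri W' i (Suc i) (Suc i) \<noteq> 0"
    and first: "n \<ge> 2 \<Longrightarrow> cmod (tri W 1 1 (Suc 1)) = cmod (tri W' 1 1 (Suc 1))"
  shows "cell_equiv (A_star n) W W'"
proof -
  interpret X: A_star_cells n q \<phi> W by (rule A_star_cells.intro) (fact assms)
  interpret Y: A_star_cells n q \<phi> W' by (rule A_star_cells.intro) (fact assms)
  have C_of_B: "cmod (X.C i) = cmod (Y.C i)"
    if "1 \<le> i" "Suc i < 2 * n" "cmod (X.B i) = cmod (Y.B i)" for i
  proof -
    have "(cmod (X.B i))\<^sup>2 + (cmod (X.C i))\<^sup>2 = (cmod (Y.B i))\<^sup>2 + (cmod (Y.C i))\<^sup>2"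
      using X.edge_I[OF that(1,2)] Y.edge_I[OF that(1,2)] by (metis of_real_eq_iff)
    then show ?thesis
      using that by simp
  qed
  have modB: "cmod (X.B i) = cmod (Y.B i)" if "1 \<le> i" "Suc i < 2 * n" for i
    using that
  proof (induction i rule: nat_induct_at_least)
    case base
    then show ?case
      using first by simp
  next
    case (Suc i)
    have i: "1 \<le> i" "Suc i < 2 * n"
      using Suc by auto
    have "cmod (X.C i) = cmod (Y.C i)"
      using Suc by (intro C_of_B) auto
    then have "(cmod (Y.C i))\<^sup>2 * (cmod (X.B (Suc i)))\<^sup>2 = (cmod (Y.C i))\<^sup>2 * (cmod (Y.B (Suc i)))\<^sup>2"
      using X.path_II[OF i Suc.prems] Y.path_II[OF i Suc.prems] by simp
    then show ?case
      using C0[OF i] by simp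
  qed
  have modC: "cmod (X.C i) = cmod (Y.C i)" if "1 \<le> i" "Suc i < 2 * n" for i
    using that by (intro C_of_B modB)
  have modA: "cmod (X.A i) = cmod (Y.A i)" if i: "1 \<le> i" "i < 2 * n" for i
  proof -
    let ?N = "common_nbrs n {i}"
    have fin: "finite ?N" and mem: "i \<in> ?N"
      using i by (auto simp: common_nbrs_def nbr_def)
    have sq: "(\<Sum>k\<in>?N. (cmod (tri V i i k))\<^sup>2)
        = (cmod (tri V i i i))\<^sup>2 + (\<Sum>k\<in>?N - {i}. (cmod (tri V i i k))\<^sup>2)" for V
      by (rule sum.remove[OF fin mem])
    have "nbr n i i"
      using i by (simp add: nbr_def)
    then have "(\<Sum>k\<in>?N. tri W i i k * cnj (tri W i i k)) = (\<Sum>k\<in>?N. tri W' i i k * cnj (tri W' i i k))"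
      using X.cells_I[of i i] Y.cells_I[of i i] by simp
    then have "(\<Sum>k\<in>?N. (cmod (tri W i i k))\<^sup>2) = (\<Sum>k\<in>?N. (cmod (tri W' i i k))\<^sup>2)"
      unfolding cnj_sq by (simp only: of_real_sum[symmetric] of_real_eq_iff)
    moreover have "(\<Sum>k\<in>?N - {i}. (cmod (tri W i i k))\<^sup>2) = (\<Sum>k\<in>?N - {i}. (cmod (tri W' i i k))\<^sup>2)"
    proof (rule sum.cong[OF refl])
      fix k
      assume "k \<in> ?N - {i}"
      then have "k = Suc i \<and> Suc i < 2 * n \<or> 1 \<le> k \<and> i = Suc k"
        by (auto simp: common_nbrs_def nbr_def)
      then show "(cmod (tri W i i k))\<^sup>2 = (cmod (tri W' i i k))\<^sup>2"
        using i modB[of i] modC[of k] X.tri_rotations[of k] Y.tri_rotations[of k] by auto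
    qed
    ultimately show ?thesis
      unfolding sq by simp
  qed
  define \<alpha> where "\<alpha> i = X.A i / Y.A i" for i
  define \<beta> where "\<beta> i = X.B i / Y.B i" for i
  define \<gamma> where "\<gamma> i = X.C i / Y.C i" for i
  have \<alpha>: "X.A i = \<alpha> i * Y.A i" "cmod (\<alpha> i) = 1" if "1 \<le> i" "i < 2 * n" for i
    using A0[OF that] modA[OF that] by (auto simp: \<alpha>_def norm_divide)
  have \<beta>: "X.B i = \<beta> i * Y.B i" "cmod (\<beta> i) = 1" if "1 \<le> i" "Suc i < 2 * n" for i
    using B0[OF that] modB[OF that] by (auto simp: \<beta>_def norm_divide)
  have \<gamma>: "X.C i = \<gamma> i * Y.C i" "cmod (\<gamma> i) = 1" if "1 \<le> i" "Suc i < 2 * n" for i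
    using C0[OF that] modC[OF that] by (auto simp: \<gamma>_def norm_divide)
  have step: "\<alpha> (Suc i) * \<beta> i ^ 3 = \<alpha> i * \<gamma> i ^ 3" if i: "1 \<le> i" "Suc i < 2 * n" for i
  proof -
    have i': "i < 2 * n" "1 \<le> Suc i"
      using i by auto
    define P where "P = Y.A i * Y.C i * (cnj (Y.B i))\<^sup>2 / \<phi> i"
    define Q where "Q = Y.B i * Y.A (Suc i) * (cnj (Y.C i))\<^sup>2 / \<phi> (Suc i)"
    have PQ: "P + Q = 0"
      unfolding P_def Q_def by (rule Y.phase_II[OF i])
    have "P \<noteq> 0"
      using A0[OF i(1) i'(1)] B0[OF i] C0[OF i] X.phi_gt_0[OF i(1) i'(1)] by (simp add: P_def)
    have "\<alpha> i * \<gamma> i * (cnj (\<beta> i))\<^sup>2 * P + \<beta> i * \<alpha> (Suc i) * (cnj (\<gamma> i))\<^sup>2 * Q = 0"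
      using X.phase_II[OF i] 
      by (simp add: \<alpha>(1)[OF i(1) i'(1)] \<alpha>(1)[OF i'(2) i(2)] \<beta>(1)[OF i] \<gamma>(1)[OF i] P_def Q_def power_mult_distrib mult_ac)
    then have "\<alpha> i * \<gamma> i * (cnj (\<beta> i))\<^sup>2 = \<beta> i * \<alpha> (Suc i) * (cnj (\<gamma> i))\<^sup>2"
      using PQ \<open>P \<noteq> 0\<close> by algebra
    moreover have "\<beta> i * cnj (\<beta> i) = 1" "\<gamma> i * cnj (\<gamma> i) = 1"
      using \<beta>(2)[OF i] \<gamma>(2)[OF i] by (simp_all only: cnj_sq) simp_all
    ultimately show ?thesis
      by algebra
  qed
  obtain \<omega> where \<omega>: "\<omega> ^ 3 = \<alpha> 1" "cmod \<omega> = 1"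
    using unimodular_cube_root[of "\<alpha> 1"] \<alpha>(2)[of 1] n by auto
  define u where "u i = \<omega> * (\<Prod>j\<in>{1..<i}. \<gamma> j / \<beta> j)" for i
  have u_Suc: "u (Suc i) = u i * \<gamma> i / \<beta> i" if "1 \<le> i" for i
    using that by (simp add: u_def)
  have u_norm: "cmod (u i) = 1" if "i < 2 * n" for i
    using that \<omega>(2) \<beta>(2) \<gamma>(2)
    by (auto simp: u_def norm_mult prod_norm[symmetric] norm_divide intro!: prod.neutral)
  have u_cube: "u i ^ 3 = \<alpha> i" if "1 \<le> i" "i < 2 * n" for i
    using that
  proof (induction i rule: nat_induct_at_least)
    case base
    then show ?case
      using \<omega> by (simp add: u_def)
  next
    case (Suc i)
    then have i: "1 \<le> i" "Suc i < 2 * n" by auto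
    have "\<beta> i \<noteq> 0"
      using \<beta>(2)[OF i] by auto
    moreover have "u (Suc i) ^ 3 = \<alpha> i * \<gamma> i ^ 3 / \<beta> i ^ 3"
      using Suc i by (simp add: u_Suc power_mult_distrib power_divide)
    ultimately show ?case
      using step[OF i, symmetric] by simp
  qed
  \<comment> \<open>Only the product of the factors of \<open>i \<rightarrow> i + 1\<close> and \<open>i + 1 \<rightarrow> i\<close> matters, so the whole
    factor \<open>v\<^sub>i = \<beta> i / u i\<close> is put on the first of them.\<close>
  define U where "U \<sigma> (\<sigma>'::nat \<times> nat) =
      (if snd \<sigma> = fst \<sigma> then u (fst \<sigma>) else if snd \<sigma> = Suc (fst \<sigma>) then \<beta> (fst \<sigma>) / u (fst \<sigma>) else 1)"
    for \<sigma> \<sigma>' :: "nat \<times> nat"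
  have U_norm: "cmod (U (i, j) \<sigma>') = 1" if "nbr n i j" for i j \<sigma>'
    using that by (auto simp: U_def nbr_def u_norm norm_divide \<beta>(2))
  have U_tri: "tri W i j k = U (i, j) (i, j) * U (j, k) (j, k) * U (k, i) (k, i) * tri W' i j k"
    if nbrs: "nbr n i j" "nbr n j k" "nbr n k i" for i j k
  proof -
    have BC: "X.B l = u l * (\<beta> l / u l) * Y.B l" "X.C l = u (Suc l) * (\<beta> l / u l) * Y.C l"
      if l: "1 \<le> l" "Suc l < 2 * n" for l
    proof -
      have "u l \<noteq> 0" "\<beta> l \<noteq> 0"
        using u_norm[of l] \<beta>(2)[OF l] l by auto
      then show "X.B l = u l * (\<beta> l / u l) * Y.B l" "X.C l = u (Suc l) * (\<beta> l / u l) * Y.C l"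
        using \<beta>(1)[OF l] \<gamma>(1)[OF l] u_Suc[OF l(1)] by simp_all
    qed
    show ?thesis
      using nbrs
    proof (cases rule: triangle_cases)
      case loop
      have "U (i, i) (i, i) * U (i, i) (i, i) * U (i, i) (i, i) = \<alpha> i"
        using u_cube[OF loop(3,4)] by (simp add: U_def power3_eq_cube)
      then show ?thesis
        using loop \<alpha>(1) by simp
    next
      case (edge l)
      note l = edge(1,2)
      show ?thesis
        using edge(3)
        by (auto simp: X.tri_rotations[OF l] Y.tri_rotations[OF l] U_def BC[OF l])
    qed
  qed
  show ?thesis
    unfolding cell_equiv_def
  proof (intro exI[of _ U] conjI ballI)
    fix i j
    show "unitary_on (edges (A_star n) i j) U"
    proof (cases "nbr n i j")
      case True
      have "U (i, j) (i, j) * cnj (U (i, j) (i, j)) = 1"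
        using U_norm[OF True] by (simp add: cnj_sq)
      then show ?thesis
        using True by (simp add: unitary_on_def edges_A_star mult.commute)
    qed (simp add: unitary_on_def edges_A_star)
  next
    fix i j k \<sigma> \<rho> \<gamma>'
    assume "\<sigma> \<in> edges (A_star n) i j" "\<rho> \<in> edges (A_star n) j k" "\<gamma>' \<in> edges (A_star n) k i"
    then have "nbr n i j" "nbr n j k" "nbr n k i" "\<sigma> = (i, j)" "\<rho> = (j, k)" "\<gamma>' = (k, i)"
      by (auto simp: edges_A_star split: if_splits)
    then show "W \<sigma> \<rho> \<gamma>' = (\<Sum>\<sigma>'\<in>edges (A_star n) i j. \<Sum>\<rho>'\<in>edges (A_star n) j k.
        \<Sum>\<gamma>''\<in>edges (A_star n) k i. U \<sigma> \<sigma>' * U \<rho> \<rho>' * U \<gamma>' \<gamma>'' * W' \<sigma>' \<rho>' \<gamma>'')"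
      using U_tri[of i j k] by (simp add: sum_edges_A_star tri_def)
  qed
qed

text \<open>The entry of a unitary matrix of size one has modulus one.\<close>

lemma cell_equiv_cmod_tri:
  assumes "cell_equiv (A_star n) W W'" "nbr n i j" "nbr n j k" "nbr n k i"
  shows "cmod (tri W i j k) = cmod (tri W' i j k)"
proof -
  from assms(1) obtain u where u: "\<forall>i\<in>verts (A_star n). \<forall>j\<in>verts (A_star n). unitary_on (edges (A_star n) i j) u"
    and W: "\<forall>i\<in>verts (A_star n). \<forall>j\<in>verts (A_star n). \<forall>k\<in>verts (A_star n).
        \<forall>\<sigma>\<in>edges (A_star n) i j. \<forall>\<rho>\<in>edges (A_star n) j k. \<forall>\<gamma>\<in>edges (A_star n) k i.
          W \<sigma> \<rho> \<gamma> = (\<Sum>\<sigma>'\<in>edges (A_star n) i j. \<Sum>\<rho>'\<in>edges (A_star n) j k. \<Sum>\<gamma>'\<in>edges (A_star n) k i.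
             u \<sigma> \<sigma>' * u \<rho> \<rho>' * u \<gamma> \<gamma>' * W' \<sigma>' \<rho>' \<gamma>')"
    unfolding cell_equiv_def by blast
  have verts: "i \<in> verts (A_star n)" "j \<in> verts (A_star n)" "k \<in> verts (A_star n)"
    using assms by (auto simp: nbr_def A_star_def)
  have norm: "cmod (u (a, b) (a, b)) = 1" if "nbr n a b" for a b
  proof -
    have "unitary_on (edges (A_star n) a b) u"
      using u that by (auto simp: nbr_def A_star_def)
    then have "u (a, b) (a, b) * cnj (u (a, b) (a, b)) = 1"
      using that by (simp add: unitary_on_def edges_A_star)
    then have "(cmod (u (a, b) (a, b)))\<^sup>2 = 1"
      unfolding cnj_sq of_real_eq_1_iff .
    then show ?thesis
      by (simp add: power2_eq_1_iff) (use norm_ge_zero[of "u (a, b) (a, b)"] in linarith)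
  qed
  have "tri W i j k = u (i, j) (i, j) * u (j, k) (j, k) * u (k, i) (k, i) * tri W' i j k"
    using W[rule_format, OF verts, of "(i, j)" "(j, k)" "(k, i)"] assms(2-4)
    by (simp add: edges_A_star tri_def)
  then show ?thesis
    using assms(2-4) by (simp add: norm_mult norm)
qed

section \<open>Trigonometry of the two solutions\<close>

lemma sin_shift_expand:
  fixes x \<theta> :: real
  shows "sin x = sin (x + \<theta>) * cos \<theta> - cos (x + \<theta>) * sin \<theta>"
    "sin (x + 2 * \<theta>) = sin (x + \<theta>) * cos \<theta> + cos (x + \<theta>) * sin \<theta>"
  using sin_add[of "x + \<theta>" \<theta>] sin_diff[of "x + \<theta>" \<theta>] by (simp_all add: algebra_simps)

lemma sin_three_term: "sin x + sin (x + 2 * \<theta>) = 2 * cos \<theta> * sin (x + \<theta>)" for x \<theta> :: real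
  using sin_shift_expand[of x \<theta>] by algebra

lemma sin_mult_sin_shift: "sin x * sin (x + 2 * \<theta>) = (sin (x + \<theta>))\<^sup>2 - (sin \<theta>)\<^sup>2" for x \<theta> :: real
  using sin_shift_expand[of x \<theta>] sin_cos_squared_add[of "x + \<theta>"] sin_cos_squared_add[of \<theta>]
  by algebra

text \<open>The next two identities are the type I equation of a loop and the equation of the square
  \<open>i, i + 1, i, i + 1\<close> for the two solutions: up to a common factor,
  \<open>sin (2 * x + (2 * k + 1) * \<theta>)\<close> stands for \<open>\<phi> (i + k)\<close>, and \<open>sin (x + k * \<theta>)\<close> for the sequence
  \<open>t (i + k)\<close> below.\<close>

lemma sin_vertex_I:
  fixes x \<theta> :: real
  shows "sin (2 * x - \<theta>) * (sin (x + \<theta>))\<^sup>2 + sin (2 * x + \<theta>) * (sin \<theta>)\<^sup>2 + sin (2 * x + 3 * \<theta>) * (sin x)\<^sup>2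
    = 2 * cos \<theta> * sin (2 * x + \<theta>) * sin x * sin (x + \<theta>)"
proof -
  define S C s c where "S = sin x" and "C = cos x" and "s = sin \<theta>" and "c = cos \<theta>"
  have 3: "sin (3 * \<theta>) = s * (2 * c * c) + s * (c * c - s * s)" "cos (3 * \<theta>) = c * (c * c - s * s) - s * (2 * s * c)"
    using sin_add[of "2 * \<theta>" \<theta>, unfolded sin_double cos_double]
      cos_add[of "2 * \<theta>" \<theta>, unfolded sin_double cos_double]
    by (simp_all add: s_def c_def power2_eq_square mult_ac)
  have "S\<^sup>2 + C\<^sup>2 = 1" "s\<^sup>2 + c\<^sup>2 = 1"
    by (simp_all add: S_def C_def s_def c_def)
  then show ?thesis
    unfolding sin_add sin_diff sin_double cos_double cos_add 3
    unfolding S_def[symmetric] C_def[symmetric] s_def[symmetric] c_def[symmetric]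
    by algebra
qed

lemma sin_edge_II:
  fixes x \<theta> :: real
  shows "sin (2 * x + 3 * \<theta>) * (sin x)\<^sup>2 + sin (2 * x + \<theta>) * (sin (x + 2 * \<theta>))\<^sup>2
    = (sin (2 * x + \<theta>) + sin (2 * x + 3 * \<theta>)) * (sin (x + \<theta>))\<^sup>2"
proof -
  \<comment> \<open>Expanding around \<open>x + \<theta>\<close> keeps the polynomials small.\<close>
  define S C s c where "S = sin (x + \<theta>)" and "C = cos (x + \<theta>)" and "s = sin \<theta>" and "c = cos \<theta>"
  have x: "2 * x + \<theta> = 2 * (x + \<theta>) - \<theta>" "2 * x + 3 * \<theta> = 2 * (x + \<theta>) + \<theta>" "x + 2 * \<theta> = (x + \<theta>) + \<theta>"
    by simp_all
  have x': "sin x = S * c - C * s"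
    using sin_diff[of "x + \<theta>" \<theta>] by (simp add: S_def C_def s_def c_def)
  have "S\<^sup>2 + C\<^sup>2 = 1" "s\<^sup>2 + c\<^sup>2 = 1"
    by (simp_all add: S_def C_def s_def c_def)
  then show ?thesis
    unfolding x sin_add[of "2 * (x + \<theta>)"] sin_diff[of "2 * (x + \<theta>)"] sin_double cos_double sin_add[of "x + \<theta>"] x'
    unfolding S_def[symmetric] C_def[symmetric] s_def[symmetric] c_def[symmetric]
    by algebra
qed

text \<open>The solutions for both signs are values of one sine function: the shift in \<open>ang\<close> is \<open>0\<close> for
  \<open>\<epsilon> = 1\<close> and \<open>pi / 2\<close> for \<open>\<epsilon> = - 1\<close>. The same shift changes \<open>sin (2 * ang i + z)\<close> by the
  factor \<open>\<epsilon>\<close>.\<close>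

locale root_with_sign =
  fixes n :: nat and \<epsilon> :: real
  assumes n: "n \<ge> 1" and \<epsilon>: "\<epsilon> = 1 \<or> \<epsilon> = - 1"
begin

definition \<theta> :: real where "\<theta> = pi / (4 * real n)"

definition ang :: "nat \<Rightarrow> real" where "ang i = (2 * real i - 1) * \<theta> / 2 + (1 - \<epsilon>) * pi / 4"

definition t :: "nat \<Rightarrow> real" where "t i = sin (ang i)"

lemma ang_Suc: "ang (Suc i) = ang i + \<theta>"
  by (simp add: ang_def field_simps)

lemma theta_bounds: "0 < \<theta>" "\<theta> \<le> pi / 4" "4 * real n * \<theta> = pi"
  using n by (simp_all add: \<theta>_def field_simps)

lemma sin_theta_pos: "sin \<theta> > 0"
  using theta_bounds pi_gt_zero by (intro sin_gt_zero) linarith+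

lemma qn_theta: "qn n m = sin (of_int m * \<theta>) / sin \<theta>"
  by (simp add: qn_sin \<theta>_def)

lemma qn_1: "qn n 1 = 1"
  using sin_theta_pos by (simp add: qn_theta)

lemma qn_2: "qn n 2 = 2 * cos \<theta>"
  using sin_theta_pos by (simp add: qn_theta sin_double)

lemma qn_2_pos: "qn n 2 > 0"
proof -
  have "cos \<theta> > 0"
    using theta_bounds pi_gt_zero by (intro cos_gt_zero_pi) linarith+
  then show ?thesis
    by (simp add: qn_2)
qed

lemma ang_trig:
  assumes "1 \<le> i" "i \<le> 2 * n"
  shows "t i > 0" "\<epsilon> * cos (ang i) > 0"
proof -
  let ?y = "(2 * real i - 1) * \<theta> / 2"
  have "(2 * real i - 1) * \<theta> \<le> (4 * real n - 1) * \<theta>"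
    using assms theta_bounds by (intro mult_right_mono) linarith+
  also have "\<dots> = pi - \<theta>"
    using theta_bounds(3) by (simp add: algebra_simps)
  finally have y: "0 < ?y" "?y < pi / 2"
    using assms theta_bounds by auto
  then have "sin ?y > 0" "cos ?y > 0"
    using pi_gt_zero by (auto intro: sin_gt_zero cos_gt_zero)
  then show "t i > 0" "\<epsilon> * cos (ang i) > 0"
    using \<epsilon> by (auto simp: t_def ang_def sin_add cos_add)
qed

lemma sin_signed: "\<epsilon> * sin (2 * ang i + z) = sin ((2 * real i - 1) * \<theta> + z)"
proof -
  have "2 * ang i + z = ((2 * real i - 1) * \<theta> + z) + (1 - \<epsilon>) * pi / 2"
    by (simp add: ang_def field_simps)
  then show ?thesis
    using \<epsilon> by (auto simp: sin_add)
qed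

lemma qn_even: "qn n (2 * int i) = \<epsilon> * sin (2 * ang i + \<theta>) / sin \<theta>"
  unfolding sin_signed qn_theta by (simp add: algebra_simps)

lemma qn_odd: "qn n (2 * int i - 1) = 2 * \<epsilon> * sin (ang i) * cos (ang i) / sin \<theta>"
proof -
  have "qn n (2 * int i - 1) = \<epsilon> * sin (2 * ang i) / sin \<theta>"
    using sin_signed[of i 0] by (simp add: qn_theta)
  then show ?thesis
    by (simp add: sin_double)
qed

lemma eps_sq: "\<epsilon> * \<epsilon> = 1" "\<epsilon> \<noteq> 0"
  using \<epsilon> by auto

lemma sin_ang:
  "sin (2 * ang i + \<theta>) = sin (ang (Suc i)) * cos (ang i) + cos (ang (Suc i)) * sin (ang i)"
  "sin \<theta> = sin (ang (Suc i)) * cos (ang i) - cos (ang (Suc i)) * sin (ang i)"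
  unfolding sin_add[symmetric] sin_diff[symmetric] by (simp_all add: ang_Suc)

lemma cos_ang:
  "cos (2 * ang i + \<theta>) = cos (ang (Suc i)) * cos (ang i) - sin (ang (Suc i)) * sin (ang i)"
  "cos \<theta> = cos (ang (Suc i)) * cos (ang i) + sin (ang (Suc i)) * sin (ang i)"
  unfolding cos_add[symmetric] cos_diff[symmetric] by (simp_all add: ang_Suc)

lemma qn_even_minus: "qn n (2 * int i) - \<epsilon> * qn n 1 = 2 * \<epsilon> * t i * cos (ang (Suc i)) / sin \<theta>"
proof -
  have "sin (2 * ang i + \<theta>) - sin \<theta> = 2 * sin (ang i) * cos (ang (Suc i))"
    unfolding sin_ang[of i] by simp
  moreover have "qn n (2 * int i) - \<epsilon> * qn n 1 = \<epsilon> * (sin (2 * ang i + \<theta>) - sin \<theta>) / sin \<theta>"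
    unfolding qn_even qn_1 using sin_theta_pos by (simp add: field_simps)
  ultimately show ?thesis
    by (simp add: t_def)
qed

lemma qn_even_plus: "qn n (2 * int i) + \<epsilon> * qn n 1 = 2 * \<epsilon> * t (Suc i) * cos (ang i) / sin \<theta>"
proof -
  have "sin (2 * ang i + \<theta>) + sin \<theta> = 2 * sin (ang (Suc i)) * cos (ang i)"
    unfolding sin_ang[of i] by simp
  moreover have "qn n (2 * int i) + \<epsilon> * qn n 1 = \<epsilon> * (sin (2 * ang i + \<theta>) + sin \<theta>) / sin \<theta>"
    unfolding qn_even qn_1 using sin_theta_pos by (simp add: field_simps)
  ultimately show ?thesis
    by (simp add: t_def)
qed

text \<open>Since \<open>[4i] = [2i] * 2 cos (2 i \<theta>)\<close>, the radicand of \<open>W\<^bsub>i,i,i\<^esub>\<close> is \<open>2 * [2i]\<close> times a sum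
  of two cosines.\<close>

lemma qn_four: "qn n 2 * qn n (2 * int i) + \<epsilon> * qn n (4 * int i)
    = 4 * qn n (2 * int i) * cos (ang i) * cos (ang (Suc i))"
proof -
  have c: "cos (2 * ang i + \<theta>) + cos \<theta> = 2 * cos (ang (Suc i)) * cos (ang i)"
    unfolding cos_ang[of i] by simp
  have e: "cos (2 * real i * \<theta>) = \<epsilon> * cos (2 * ang i + \<theta>)"
  proof -
    have "2 * ang i + \<theta> = 2 * real i * \<theta> + (1 - \<epsilon>) * pi / 2"
      by (simp add: ang_def field_simps)
    then show ?thesis
      using \<epsilon> by (auto simp: cos_add)
  qed
  have "qn n (4 * int i) = 2 * qn n (2 * int i) * cos (2 * real i * \<theta>)"
    using sin_double[of "2 * real i * \<theta>"] by (simp add: qn_theta mult.assoc)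
  then have "\<epsilon> * qn n (4 * int i) = 2 * qn n (2 * int i) * cos (2 * ang i + \<theta>)"
    using eps_sq(1) unfolding e by (simp add: mult_ac) 
  then have "qn n 2 * qn n (2 * int i) + \<epsilon> * qn n (4 * int i)
      = 2 * qn n (2 * int i) * (cos (2 * ang i + \<theta>) + cos \<theta>)"
    by (simp add: qn_2 algebra_simps)
  then show ?thesis
    unfolding c by simp
qed

lemma phi_pos: "phi_star n i > 0" if "1 \<le> i" "i < 2 * n"
proof -
  have "real i * \<theta> < 2 * real n * \<theta>"
    using that theta_bounds by (intro mult_strict_right_mono) linarith+
  then have "0 < 2 * real i * \<theta>" "2 * real i * \<theta> < pi"
    using that theta_bounds unfolding mult.assoc by (simp, linarith)
  then have "sin (2 * real i * \<theta>) > 0"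
    by (intro sin_gt_zero)
  then show ?thesis
    using sin_theta_pos qn_2_pos by (simp add: phi_star_def qn_theta[of "2 * int i"])
qed

text \<open>The eigenvector vanishes at the virtual vertices, and so will the cells there.\<close>

lemma phi_boundary: "phi_star n 0 = 0" "phi_star n (2 * n) = 0"
  using theta_bounds(3) by (simp_all add: phi_star_def qn_theta[of 0] qn_theta[of "4 * int n"])

definition \<kappa> :: real where "\<kappa> = \<epsilon> / (sin \<theta> * qn n 2)"

lemma phi_ang: "phi_star n i = \<kappa> * sin (2 * ang i + \<theta>)"
  by (simp add: phi_star_def qn_even \<kappa>_def)

lemma phi_ang_Suc: "phi_star n (Suc i) = \<kappa> * sin (2 * ang i + 3 * \<theta>)"
  by (simp add: phi_ang ang_Suc algebra_simps)

lemma phi_ang_pre: "phi_star n i = \<kappa> * sin (2 * ang (Suc i) - \<theta>)"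
  by (simp add: phi_ang ang_Suc algebra_simps)

text \<open>The square root is extended to the negative reals as an odd function, so it is multiplicative
  for all signs.\<close>

lemma sqrt_form:
  assumes "c > 0" "x / y = z"
  shows "sqrt (u * v) / (c * sqrt y) * sqrt x = sqrt (u / c * (v / c) * z)"
proof -
  have "sqrt (u / c * (v / c) * z) = sqrt (u * v * x / (c\<^sup>2 * y))"
    unfolding assms(2)[symmetric] by (simp add: power2_eq_square)
  then show ?thesis
    using assms(1) by (simp add: real_sqrt_mult real_sqrt_divide)
qed

lemma W_i_i_Si_t:
  assumes "Suc i \<le> 2 * n"
  shows "W_i_i_Si n \<epsilon> i = sqrt (phi_star n i * phi_star n (Suc i) * (t i / t (Suc i)))"
proof -
  have "\<epsilon> * cos (ang (Suc i)) \<noteq> 0" "t (Suc i) \<noteq> 0"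
    using ang_trig[of "Suc i"] assms by auto
  then have "(qn n (2 * int i) - \<epsilon> * qn n 1) / qn n (2 * int i + 1) = t i / t (Suc i)"
    using qn_odd[of "Suc i"] sin_theta_pos by (simp add: qn_even_minus t_def add.commute)
  from sqrt_form[OF qn_2_pos this, of "qn n (2 * int i)" "qn n (2 * int i + 2)"] show ?thesis
    unfolding W_i_i_Si_def phi_star_def by (simp add: algebra_simps)
qed

lemma W_i_Si_Si_t:
  assumes "Suc i \<le> 2 * n"
  shows "W_i_Si_Si n \<epsilon> i = sqrt (phi_star n i * phi_star n (Suc i) * (t (Suc (Suc i)) / t (Suc i)))"
proof -
  have "\<epsilon> * cos (ang (Suc i)) \<noteq> 0" "t (Suc i) \<noteq> 0"
    using ang_trig[of "Suc i"] assms by auto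
  then have "(qn n (2 * int i + 2) + \<epsilon> * qn n 1) / qn n (2 * int i + 1) = t (Suc (Suc i)) / t (Suc i)"
    using qn_odd[of "Suc i"] qn_even_plus[of "Suc i"] sin_theta_pos by (simp add: t_def add.commute)
  from sqrt_form[OF qn_2_pos this, of "qn n (2 * int i)" "qn n (2 * int i + 2)"] show ?thesis
    unfolding W_i_Si_Si_def phi_star_def by (simp add: algebra_simps)
qed

text \<open>The first case of the definition is valid at all vertices, because \<open>[4n] = 0\<close> and
  \<open>[8n - 4i] = - [4i]\<close>.\<close>

lemma W_i_i_i_uniform:
  "W_i_i_i n \<epsilon> i = (-1) ^ (i + 1) * (sqrt (qn n (2 * int i))
          / (qn n 2 * sqrt (qn n (2 * int i - 1) * qn n (2 * int i + 1))))
        * sqrt (qn n 2 * qn n (2 * int i) + \<epsilon> * qn n (4 * int i))"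
proof (cases i n rule: linorder_cases)
  case equal
  have zero: "qn n (4 * int n) = 0"
    using theta_bounds(3) by (simp add: qn_theta)
  have nonneg: "qn n (2 * int n) \<ge> 0"
    using phi_pos[of n] n qn_2_pos by (simp add: phi_star_def zero_less_divide_iff)
  have key: "sqrt a / (qn n 2 * sqrt d) * sqrt (qn n 2 * a) = a / sqrt (qn n 2 * d)"
    if "a \<ge> 0" for a d
  proof -
    have "sqrt a / (qn n 2 * sqrt d) * sqrt (qn n 2 * a)
        = (sqrt (qn n 2) / qn n 2) * (sqrt a * sqrt a) / sqrt d"
      by (simp add: real_sqrt_mult)
    also have "sqrt (qn n 2) / qn n 2 = 1 / sqrt (qn n 2)"
      using qn_2_pos by (simp add: field_simps)
    finally show ?thesis
      using that by (simp add: real_sqrt_mult)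
  qed
  have "W_i_i_i n \<epsilon> n
      = (-1) ^ (n + 1) * (qn n (2 * int n) / sqrt (qn n 2 * (qn n (2 * int n - 1) * qn n (2 * int n + 1))))"
    by (simp add: W_i_i_i_def mult.assoc)
  also have "\<dots> = (-1) ^ (n + 1) * (sqrt (qn n (2 * int n))
        / (qn n 2 * sqrt (qn n (2 * int n - 1) * qn n (2 * int n + 1)))
        * sqrt (qn n 2 * qn n (2 * int n) + \<epsilon> * qn n (4 * int n)))"
    by (simp only: key[OF nonneg] zero mult_zero_right add_0_right)
  finally show ?thesis
    unfolding equal by (simp only: mult.assoc)
next
  case greater
  have "qn n (8 * int n - 4 * int i) = - qn n (4 * int i)"
  proof -
    have "of_int (8 * int n - 4 * int i) * \<theta> = 2 * pi - 4 * real i * \<theta>"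
      using theta_bounds(3) by (simp add: algebra_simps)
    then show ?thesis
      by (simp add: qn_theta sin_diff)
  qed
  then show ?thesis
    using greater by (simp add: W_i_i_i_def)
qed (simp add: W_i_i_i_def)

text \<open>The double-angle formulas for \<open>[2i - 1]\<close>, \<open>[2i + 1]\<close> contain the same cosines as the radicand,
  and these cancel.\<close>

lemma W_i_i_i_t:
  assumes "1 \<le> i" "i < 2 * n"
  shows "W_i_i_i n \<epsilon> i = (-1) ^ (i + 1) * (phi_star n i * sin \<theta> / sqrt (t i * t (Suc i)))"
proof -
  define C where "C = cos (ang i) * cos (ang (Suc i))"
  have "C = (\<epsilon> * cos (ang i)) * (\<epsilon> * cos (ang (Suc i)))"
    using eps_sq(1) by (simp add: C_def algebra_simps)
  then have C: "C > 0"
    using ang_trig[of i] ang_trig[of "Suc i"] assms by simp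
  have tt: "t i * t (Suc i) > 0"
    using ang_trig[of i] ang_trig[of "Suc i"] assms by simp
  have q: "qn n (2 * int i) \<ge> 0"
    using phi_pos[of i] assms qn_2_pos by (simp add: phi_star_def zero_less_divide_iff)
  have odd: "qn n (2 * int i - 1) * qn n (2 * int i + 1) = 4 * C * (t i * t (Suc i)) / (sin \<theta>)\<^sup>2"
    using qn_odd[of i] qn_odd[of "Suc i"] eps_sq(1)
    by (simp add: C_def t_def power2_eq_square add.commute)
  have "sqrt (qn n (2 * int i)) / (qn n 2 * sqrt (qn n (2 * int i - 1) * qn n (2 * int i + 1)))
      * sqrt (qn n 2 * qn n (2 * int i) + \<epsilon> * qn n (4 * int i))
    = sqrt (qn n (2 * int i)) / (qn n 2 * sqrt (4 * C * (t i * t (Suc i)) / (sin \<theta>)\<^sup>2))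
      * sqrt (4 * qn n (2 * int i) * C)"
    unfolding odd qn_four by (simp add: C_def mult.assoc)
  also have "\<dots> = phi_star n i * sin \<theta> / sqrt (t i * t (Suc i))"
    using C sin_theta_pos q tt
    by (simp add: phi_star_def real_sqrt_mult real_sqrt_divide field_simps)
  finally show ?thesis
    unfolding W_i_i_i_uniform by (simp only: mult.assoc)
qed

end

section \<open>The two solutions are cell systems\<close>

lemma tri_W_pm: "tri (W_pm n \<epsilon>) a b c = complex_of_real (W_verts n \<epsilon> a b c)"
  by (simp add: tri_def W_pm_def)

lemma W_verts_simps:
  "W_verts n \<epsilon> i i i = W_i_i_i n \<epsilon> i"
  "W_verts n \<epsilon> i i (Suc i) = W_i_i_Si n \<epsilon> i"
  "W_verts n \<epsilon> i (Suc i) i = W_i_i_Si n \<epsilon> i"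
  "W_verts n \<epsilon> (Suc i) i i = W_i_i_Si n \<epsilon> i"
  "W_verts n \<epsilon> i (Suc i) (Suc i) = W_i_Si_Si n \<epsilon> i"
  "W_verts n \<epsilon> (Suc i) (Suc i) i = W_i_Si_Si n \<epsilon> i"
  "W_verts n \<epsilon> (Suc i) i (Suc i) = W_i_Si_Si n \<epsilon> i"
  by (simp_all add: W_verts_def)

context root_with_sign
begin

abbreviation "\<phi> \<equiv> phi_star n"
abbreviation "a \<equiv> W_i_i_i n \<epsilon>"
abbreviation "b \<equiv> W_i_i_Si n \<epsilon>"
abbreviation "c \<equiv> W_i_Si_Si n \<epsilon>"

lemma ang_Suc_Suc: "ang (Suc (Suc i)) = ang i + 2 * \<theta>"
  by (simp add: ang_Suc)

lemma t_recursion: "t i + t (Suc (Suc i)) = qn n 2 * t (Suc i)"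
  unfolding t_def ang_Suc_Suc qn_2 unfolding ang_Suc by (rule sin_three_term)

lemma t_log_concave: "t i * t (Suc (Suc i)) + (sin \<theta>)\<^sup>2 = (t (Suc i))\<^sup>2"
  unfolding t_def ang_Suc_Suc unfolding ang_Suc sin_mult_sin_shift by simp

lemma phi_t_edge:
  "\<phi> (Suc i) * (t i)\<^sup>2 + \<phi> i * (t (Suc (Suc i)))\<^sup>2 = (\<phi> i + \<phi> (Suc i)) * (t (Suc i))\<^sup>2"
proof -
  have "\<kappa> * (sin (2 * ang i + 3 * \<theta>) * (sin (ang i))\<^sup>2 + sin (2 * ang i + \<theta>) * (sin (ang i + 2 * \<theta>))\<^sup>2)
    = \<kappa> * ((sin (2 * ang i + \<theta>) + sin (2 * ang i + 3 * \<theta>)) * (sin (ang i + \<theta>))\<^sup>2)"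
    by (simp only: sin_edge_II)
  moreover have "ang (Suc (Suc i)) = ang i + 2 * \<theta>"
    by (simp add: ang_Suc)
  ultimately show ?thesis
    unfolding t_def phi_ang_Suc[of i] phi_ang[of i] ang_Suc[of i]
    by (simp add: algebra_simps)
qed

lemma phi_t_vertex:
  "\<phi> i * (t (Suc (Suc i)))\<^sup>2 + \<phi> (Suc i) * (sin \<theta>)\<^sup>2 + \<phi> (Suc (Suc i)) * (t (Suc i))\<^sup>2
    = qn n 2 * \<phi> (Suc i) * t (Suc i) * t (Suc (Suc i))"
proof -
  let ?x = "ang (Suc i)"
  have "\<kappa> * (sin (2 * ?x - \<theta>) * (sin (?x + \<theta>))\<^sup>2 + sin (2 * ?x + \<theta>) * (sin \<theta>)\<^sup>2 + sin (2 * ?x + 3 * \<theta>) * (sin ?x)\<^sup>2)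
    = \<kappa> * (2 * cos \<theta> * sin (2 * ?x + \<theta>) * sin ?x * sin (?x + \<theta>))"
    by (simp only: sin_vertex_I)
  then show ?thesis
    unfolding t_def phi_ang_Suc[of "Suc i"] phi_ang[of "Suc i"] phi_ang_pre[of i] ang_Suc[of "Suc i"] qn_2
    by (simp add: algebra_simps)
qed

text \<open>Each entry of \<open>\<phi>\<close> is a multiple of \<open>sin (2 i \<theta>)\<close>, and \<open>2 cos (2 \<theta>) = [2]\<^sup>2 - 2\<close>.\<close>

lemma phi_eigenvector: "\<phi> i + \<phi> (Suc (Suc i)) = ((qn n 2)\<^sup>2 - 2) * \<phi> (Suc i)"
proof -
  let ?y = "2 * ang (Suc i) + \<theta>"
  have e: "2 * ang (Suc i) - \<theta> = ?y - 2 * \<theta>" "2 * ang (Suc i) + 3 * \<theta> = ?y + 2 * \<theta>"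
    by simp_all
  have "(qn n 2)\<^sup>2 - 2 = 2 * cos (2 * \<theta>)"
    by (simp add: qn_2 cos_double_cos power_mult_distrib)
  then show ?thesis
    unfolding phi_ang_Suc[of "Suc i"] phi_ang[of "Suc i"] phi_ang_pre[of i] e sin_add[of ?y] sin_diff[of ?y]
    by (simp add: algebra_simps)
qed

lemma qn_3: "qn n 3 = (qn n 2)\<^sup>2 - 1"
proof -
  have "sin (3 * \<theta>) = sin (2 * \<theta>) * cos \<theta> + cos (2 * \<theta>) * sin \<theta>"
    using sin_add[of "2 * \<theta>" \<theta>] by simp
  also have "\<dots> = ((2 * cos \<theta>)\<^sup>2 - 1) * sin \<theta>"
    unfolding sin_double cos_double_cos by (simp add: power2_eq_square algebra_simps)
  finally show ?thesis
    using sin_theta_pos by (simp add: qn_theta[of 3] qn_2)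
qed

lemma pf_digraph_A_star: "pf_digraph (A_star n) (q_root n) \<phi>"
proof (rule pf_digraph_A_starI)
  show "complex_of_real (\<phi> i + \<phi> (Suc i) + \<phi> (Suc (Suc i))) = q_int (q_root n) 3 * \<phi> (Suc i)" for i
    using phi_eigenvector[of i] unfolding of_real_qn[symmetric] of_real_mult[symmetric] of_real_eq_iff qn_3
    by (simp add: algebra_simps)
qed (auto simp: phi_pos phi_boundary)

lemma phi_nonneg: "i \<le> 2 * n \<Longrightarrow> \<phi> i \<ge> 0"
  using phi_pos[of i] phi_boundary by (cases "i = 0 \<or> i = 2 * n") (auto intro: less_imp_le)

lemma a_sq: "1 \<le> i \<Longrightarrow> i < 2 * n \<Longrightarrow> (a i)\<^sup>2 = (\<phi> i)\<^sup>2 * (sin \<theta>)\<^sup>2 / (t i * t (Suc i))"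
  using ang_trig(1)[of i] ang_trig(1)[of "Suc i"]
  by (simp add: W_i_i_i_t power_mult_distrib power_divide flip: power_mult)

lemma b_sq: "(b i)\<^sup>2 = \<phi> i * \<phi> (Suc i) * (t i / t (Suc i))" if "i < 2 * n"
proof (cases "i = 0")
  case False
  then show ?thesis
    using that ang_trig(1)[of i] ang_trig(1)[of "Suc i"] phi_nonneg[of i] phi_nonneg[of "Suc i"]
    by (simp add: W_i_i_Si_t)
qed (use that in \<open>simp add: W_i_i_Si_t phi_boundary\<close>)

lemma c_sq: "(c i)\<^sup>2 = \<phi> i * \<phi> (Suc i) * (t (Suc (Suc i)) / t (Suc i))" if "i < 2 * n"
proof (cases "Suc i = 2 * n")
  case False
  then show ?thesis
    using that ang_trig(1)[of "Suc (Suc i)"] ang_trig(1)[of "Suc i"] phi_nonneg[of i] phi_nonneg[of "Suc i"]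
    by (simp add: W_i_Si_Si_t)
next
  case True
  then show ?thesis
    using that by (simp add: W_i_Si_Si_t phi_boundary)
qed

lemma abc_nonzero:
  "1 \<le> i \<Longrightarrow> i < 2 * n \<Longrightarrow> a i \<noteq> 0"
  "1 \<le> i \<Longrightarrow> Suc i < 2 * n \<Longrightarrow> b i \<noteq> 0"
  "1 \<le> i \<Longrightarrow> Suc i < 2 * n \<Longrightarrow> c i \<noteq> 0"
proof -
  show "a i \<noteq> 0" if "1 \<le> i" "i < 2 * n"
    using that ang_trig(1)[of i] ang_trig(1)[of "Suc i"] phi_pos[of i] sin_theta_pos by (simp add: W_i_i_i_t)
  show "b i \<noteq> 0" if "1 \<le> i" "Suc i < 2 * n"
    using that ang_trig(1)[of i] ang_trig(1)[of "Suc i"] phi_pos[of i] phi_pos[of "Suc i"] by (simp add: W_i_i_Si_t)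
  show "c i \<noteq> 0" if "1 \<le> i" "Suc i < 2 * n"
    using that ang_trig(1)[of "Suc (Suc i)"] ang_trig(1)[of "Suc i"] phi_pos[of i] phi_pos[of "Suc i"] by (simp add: W_i_Si_Si_t)
qed

lemma edge_equations:
  assumes i: "1 \<le> i" "Suc i < 2 * n"
  shows "b i * b i + c i * c i = qn n 2 * \<phi> i * \<phi> (Suc i)"
    and "inverse (\<phi> i) * (a i * a i * b i * b i) + inverse (\<phi> (Suc i)) * (b i * b i * c i * c i)
       = \<phi> i * \<phi> i * \<phi> (Suc i)"
    and "inverse (\<phi> i) * (b i * b i * c i * c i) + inverse (\<phi> (Suc i)) * (a (Suc i) * a (Suc i) * c i * c i)
       = \<phi> i * \<phi> (Suc i) * \<phi> (Suc i)"
    and "inverse (\<phi> i) * (b i * b i * b i * b i) + inverse (\<phi> (Suc i)) * (c i * c i * c i * c i)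
       = \<phi> i * \<phi> (Suc i) * (\<phi> i + \<phi> (Suc i))"
    and "inverse (\<phi> i) * (a i * b i * b i * c i) + inverse (\<phi> (Suc i)) * (a (Suc i) * b i * c i * c i) = 0"
proof -
  define f f' t1 t2 t3 s where "f = \<phi> i" and "f' = \<phi> (Suc i)"
    and "t1 = t i" and "t2 = t (Suc i)" and "t3 = t (Suc (Suc i))" and "s = (sin \<theta>)\<^sup>2"
  have pos: "f > 0" "f' > 0" "t1 > 0" "t2 > 0" "t3 > 0"
    using i by (auto simp: f_def f'_def t1_def t2_def t3_def phi_pos ang_trig)
  have sq: "a i * a i = f * f * s / (t1 * t2)" "a (Suc i) * a (Suc i) = f' * f' * s / (t2 * t3)"
    "b i * b i = f * f' * t1 / t2" "c i * c i = f * f' * t3 / t2"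
    using a_sq[of i] a_sq[of "Suc i"] b_sq[of i] c_sq[of i] i
    by (simp_all add: f_def f'_def t1_def t2_def t3_def s_def power2_eq_square)
  have "b i * b i + c i * c i = f * f' * ((t1 + t3) / t2)"
    unfolding sq by (simp add: add_divide_distrib distrib_left)
  also have "(t1 + t3) / t2 = qn n 2"
    using t_recursion[of i] pos by (simp add: t1_def t2_def t3_def)
  finally show "b i * b i + c i * c i = qn n 2 * \<phi> i * \<phi> (Suc i)"
    by (simp add: f_def f'_def)
  have lc: "(s + t1 * t3) / (t2 * t2) = 1"
    using t_log_concave[of i] pos by (simp add: t1_def t2_def t3_def s_def power2_eq_square add.commute)
  have "inverse f * ((a i * a i) * (b i * b i)) + inverse f' * ((b i * b i) * (c i * c i))
      = f * f * f' * ((s + t1 * t3) / (t2 * t2))"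
    unfolding sq using pos by (simp add: divide_simps) (simp add: algebra_simps)
  then show "inverse (\<phi> i) * (a i * a i * b i * b i) + inverse (\<phi> (Suc i)) * (b i * b i * c i * c i)
       = \<phi> i * \<phi> i * \<phi> (Suc i)"
    unfolding lc by (simp add: f_def f'_def mult.assoc)
  have "inverse f * ((b i * b i) * (c i * c i)) + inverse f' * ((a (Suc i) * a (Suc i)) * (c i * c i))
      = f * f' * f' * ((s + t1 * t3) / (t2 * t2))"
    unfolding sq using pos by (simp add: divide_simps) (simp add: algebra_simps)
  then show "inverse (\<phi> i) * (b i * b i * c i * c i) + inverse (\<phi> (Suc i)) * (a (Suc i) * a (Suc i) * c i * c i)
       = \<phi> i * \<phi> (Suc i) * \<phi> (Suc i)"
    unfolding lc by (simp add: f_def f'_def mult.assoc)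
  have "inverse f * ((b i * b i) * (b i * b i)) + inverse f' * ((c i * c i) * (c i * c i))
      = f * f' * ((f' * t1\<^sup>2 + f * t3\<^sup>2) / (t2\<^sup>2))"
    unfolding sq using pos by (simp add: divide_simps power2_eq_square) (simp add: algebra_simps)
  also have "f' * t1\<^sup>2 + f * t3\<^sup>2 = (f + f') * t2\<^sup>2"
    unfolding f_def f'_def t1_def t2_def t3_def by (rule phi_t_edge)
  also have "(f + f') * t2\<^sup>2 / t2\<^sup>2 = f + f'"
    using pos by simp
  finally show "inverse (\<phi> i) * (b i * b i * b i * b i) + inverse (\<phi> (Suc i)) * (c i * c i * c i * c i)
       = \<phi> i * \<phi> (Suc i) * (\<phi> i + \<phi> (Suc i))"
    by (simp add: f_def f'_def mult.assoc)
  \<comment> \<open>Both terms of the phase equation have modulus \<open>sin \<theta> * r / t2\<close>, up to the common factor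
    \<open>b i * c i\<close>, and the alternating sign of \<open>a\<close> makes them cancel.\<close>
  define r where "r = sqrt (f * f')"
  have ab: "a i * b i = (-1) ^ (i + 1) * (f * sin \<theta> * r / t2)"
  proof -
    have "b i = r * sqrt (t1 / t2)"
      unfolding r_def real_sqrt_mult[symmetric] f_def f'_def t1_def t2_def
      using i by (intro W_i_i_Si_t) simp
    then have "a i * b i = (-1) ^ (i + 1) * (f * sin \<theta> * (r * (sqrt (t1 / t2) / sqrt (t1 * t2))))"
      using i by (simp add: W_i_i_i_t f_def t1_def t2_def)
    also have "sqrt (t1 / t2) / sqrt (t1 * t2) = 1 / t2"
      using pos by (simp add: real_sqrt_mult real_sqrt_divide)
    finally show ?thesis
      by simp
  qed
  have ac: "a (Suc i) * c i = - ((-1) ^ (i + 1) * (f' * sin \<theta> * r / t2))"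
  proof -
    have "c i = r * sqrt (t3 / t2)"
      unfolding r_def real_sqrt_mult[symmetric] f_def f'_def t3_def t2_def
      using i by (intro W_i_Si_Si_t) simp
    then have "a (Suc i) * c i = - ((-1) ^ (i + 1) * (f' * sin \<theta> * (r * (sqrt (t3 / t2) / sqrt (t2 * t3)))))"
      using i by (simp add: W_i_i_i_t f'_def t2_def t3_def)
    also have "sqrt (t3 / t2) / sqrt (t2 * t3) = 1 / t2"
      using pos by (simp add: real_sqrt_mult real_sqrt_divide)
    finally show ?thesis
      by simp
  qed
  have "inverse f * (a i * b i) + inverse f' * (a (Suc i) * c i) = 0"
    unfolding ab ac using pos by simp
  moreover have "inverse f * (a i * b i * b i * c i) + inverse f' * (a (Suc i) * b i * c i * c i)
      = b i * c i * (inverse f * (a i * b i) + inverse f' * (a (Suc i) * c i))"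
    by (simp add: algebra_simps)
  ultimately show "inverse (\<phi> i) * (a i * b i * b i * c i) + inverse (\<phi> (Suc i)) * (a (Suc i) * b i * c i * c i) = 0"
    by (simp add: f_def f'_def)
qed

lemma path_equation:
  assumes i: "1 \<le> i" "Suc (Suc i) < 2 * n"
  shows "inverse (\<phi> (Suc i)) * (b (Suc i) * b (Suc i) * c i * c i) = \<phi> i * \<phi> (Suc i) * \<phi> (Suc (Suc i))"
proof -
  have "t (Suc i) > 0" "t (Suc (Suc i)) > 0" "\<phi> (Suc i) > 0"
    using i by (auto simp: ang_trig phi_pos)
  moreover have "inverse (\<phi> (Suc i)) * (b (Suc i) * b (Suc i) * c i * c i)
      = inverse (\<phi> (Suc i)) * ((b (Suc i))\<^sup>2 * (c i)\<^sup>2)"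
    by (simp add: power2_eq_square)
  ultimately show ?thesis
    using b_sq[of "Suc i"] c_sq[of i] i by (simp add: field_simps)
qed

text \<open>In terms of \<open>P = t (i + 2) / t (i + 1)\<close> and \<open>Q = 1 / P\<close> the three squared cells at the vertex
  \<open>i + 1\<close> are \<open>\<phi> i * P\<close>, \<open>\<phi> (i + 1) * (P + Q - [2])\<close> and \<open>\<phi> (i + 2) * Q\<close>, up to the factor
  \<open>\<phi> (i + 1)\<close>. The type I equation is linear in these; multiplied by \<open>P + Q\<close> and combined with
  the eigenvector equation it yields the type II equation.\<close>

lemma vertex_equations:
  assumes "Suc i < 2 * n"
  shows "c i * c i + a (Suc i) * a (Suc i) + b (Suc i) * b (Suc i) = qn n 2 * \<phi> (Suc i) * \<phi> (Suc i)"
    and "inverse (\<phi> i) * (c i * c i * c i * c i)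
       + inverse (\<phi> (Suc i)) * (a (Suc i) * a (Suc i) * a (Suc i) * a (Suc i))
       + inverse (\<phi> (Suc (Suc i))) * (b (Suc i) * b (Suc i) * b (Suc i) * b (Suc i))
       = 2 * \<phi> (Suc i) * \<phi> (Suc i) * \<phi> (Suc i)"
proof -
  define f0 f1 f2 P Q where "f0 = \<phi> i" and "f1 = \<phi> (Suc i)" and "f2 = \<phi> (Suc (Suc i))"
    and "P = t (Suc (Suc i)) / t (Suc i)" and "Q = t (Suc i) / t (Suc (Suc i))"
  have pos: "t (Suc i) > 0" "t (Suc (Suc i)) > 0" "f1 > 0"
    using assms by (auto simp: f1_def ang_trig phi_pos)
  have PQ: "P * Q = 1"
    using pos by (simp add: P_def Q_def)
  have A: "(sin \<theta>)\<^sup>2 / (t (Suc i) * t (Suc (Suc i))) = P + Q - qn n 2"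
  proof -
    have "(sin \<theta>)\<^sup>2 = (t (Suc i))\<^sup>2 + (t (Suc (Suc i)))\<^sup>2 - qn n 2 * t (Suc i) * t (Suc (Suc i))"
      using t_log_concave[of "Suc i"] t_recursion[of "Suc i"] by algebra
    then show ?thesis
      using pos by (simp add: P_def Q_def field_simps power2_eq_square)
  qed
  have sq: "c i * c i = f0 * f1 * P" "b (Suc i) * b (Suc i) = f1 * f2 * Q"
    "a (Suc i) * a (Suc i) = f1 * f1 * (P + Q - qn n 2)"
    using a_sq[of "Suc i"] b_sq[of "Suc i"] c_sq[of i] assms
    unfolding A[symmetric] by (simp_all add: f0_def f1_def f2_def P_def Q_def power2_eq_square)
  have lin: "f0 * P + f1 * (P + Q - qn n 2) + f2 * Q = qn n 2 * f1"
  proof -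
    have "f0 * P + f1 * (P + Q - qn n 2) + f2 * Q
        = (f0 * (t (Suc (Suc i)))\<^sup>2 + f1 * (sin \<theta>)\<^sup>2 + f2 * (t (Suc i))\<^sup>2) / (t (Suc i) * t (Suc (Suc i)))"
      unfolding A[symmetric] using pos by (simp add: P_def Q_def field_simps power2_eq_square)
    also have "\<dots> = qn n 2 * f1"
      using pos phi_t_vertex[of i] by (simp add: f0_def f1_def f2_def)
    finally show ?thesis .
  qed
  have "c i * c i + a (Suc i) * a (Suc i) + b (Suc i) * b (Suc i)
      = f1 * (f0 * P + f1 * (P + Q - qn n 2) + f2 * Q)"
    unfolding sq by (simp add: algebra_simps)
  then show "c i * c i + a (Suc i) * a (Suc i) + b (Suc i) * b (Suc i) = qn n 2 * \<phi> (Suc i) * \<phi> (Suc i)"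
    unfolding lin by (simp add: f1_def)
  have eig: "f0 + f2 = ((qn n 2)\<^sup>2 - 2) * f1"
    unfolding f0_def f1_def f2_def by (rule phi_eigenvector)
  \<comment> \<open>The entries \<open>f0\<close> and \<open>f2\<close> are zero at the two ends; both sides then vanish.\<close>
  have inv: "inverse f0 * (f0 * f1 * P * (f0 * f1 * P)) = f1 * f1 * (f0 * P * P)"
    "inverse f2 * (f1 * f2 * Q * (f1 * f2 * Q)) = f1 * f1 * (f2 * Q * Q)"
    by (cases "f0 = 0"; simp) (cases "f2 = 0"; simp)
  have inv1: "inverse f1 * (f1 * f1 * R * (f1 * f1 * R)) = f1 * f1 * (f1 * R * R)" for R
    using pos by simp
  have "inverse f0 * (c i * c i * (c i * c i))
       + inverse f1 * (a (Suc i) * a (Suc i) * (a (Suc i) * a (Suc i)))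
       + inverse f2 * (b (Suc i) * b (Suc i) * (b (Suc i) * b (Suc i)))
     = f1 * f1 * (f0 * P * P + f1 * (P + Q - qn n 2) * (P + Q - qn n 2) + f2 * Q * Q)"
    unfolding sq inv inv1 by (simp only: distrib_left)
  also have "f0 * P * P + f1 * (P + Q - qn n 2) * (P + Q - qn n 2) + f2 * Q * Q
      = (P + Q) * (f0 * P + f1 * (P + Q - qn n 2) + f2 * Q - qn n 2 * f1)
        + (((qn n 2)\<^sup>2 - 2) * f1 - (f0 + f2)) * (P * Q) + 2 * f1 + ((qn n 2)\<^sup>2 - 2) * f1 * (1 - P * Q)"
    by (simp add: power2_eq_square algebra_simps)
  also have "\<dots> = 2 * f1"
    unfolding lin eig PQ by simp
  finally show "inverse (\<phi> i) * (c i * c i * c i * c i)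
       + inverse (\<phi> (Suc i)) * (a (Suc i) * a (Suc i) * a (Suc i) * a (Suc i))
       + inverse (\<phi> (Suc (Suc i))) * (b (Suc i) * b (Suc i) * b (Suc i) * b (Suc i))
       = 2 * \<phi> (Suc i) * \<phi> (Suc i) * \<phi> (Suc i)"
    by (simp add: f0_def f1_def f2_def mult.assoc)
qed

abbreviation "w \<equiv> W_verts n \<epsilon>"

lemma w_boundary:
  "l = 0 \<Longrightarrow> w (Suc l) (Suc l) 0 = 0"
  "Suc (Suc l) = 2 * n \<Longrightarrow> w (Suc l) (Suc l) (2 * n) = 0"
proof -
  show "w (Suc l) (Suc l) 0 = 0" if "l = 0"
    using W_verts_simps(6)[of n \<epsilon> 0] c_sq[of 0] n that by (simp add: phi_boundary)
  show "w (Suc l) (Suc l) (2 * n) = 0" if eq: "Suc (Suc l) = 2 * n"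
    unfolding eq[symmetric] W_verts_simps using b_sq[of "Suc l"] eq by (simp add: phi_boundary)
qed

lemma real_type_I:
  assumes "nbr n i j"
  shows "(\<Sum>k\<in>common_nbrs n {i, j}. w i j k * w i j k) = qn n 2 * \<phi> i * \<phi> j"
proof -
  consider (vertex) l where "i = Suc l" "j = Suc l" "Suc l < 2 * n"
    | (up) "j = Suc i" "1 \<le> i" "Suc i < 2 * n" | (down) "i = Suc j" "1 \<le> j" "Suc j < 2 * n"
    using assms by (cases i) (auto simp: nbr_def)
  then show ?thesis
  proof cases
    case vertex
    then have "(\<Sum>k\<in>common_nbrs n {Suc l}. w (Suc l) (Suc l) k * w (Suc l) (Suc l) k)
        = qn n 2 * \<phi> (Suc l) * \<phi> (Suc l)"
      using vertex_equations(1)[of l]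
      by (subst sum_common_nbrs_vertex) (simp_all add: w_boundary, simp_all add: W_verts_simps)
    then show ?thesis
      using vertex by simp
  next
    case up
    then show ?thesis
      using edge_equations(1)[of i] by (simp add: common_nbrs_edge W_verts_simps)
  next
    case down
    then have "common_nbrs n {i, j} = {j, Suc j}"
      using common_nbrs_edge[of j n] by (simp add: insert_commute)
    then show ?thesis
      using edge_equations(1)[of j] down by (simp add: W_verts_simps mult_ac)
  qed
qed

lemma real_type_II:
  assumes "nbr n i1 i2" "nbr n i3 i2" "nbr n i3 i4" "nbr n i1 i4"
  shows "(\<Sum>k\<in>common_nbrs n {i1, i2, i3, i4}. inverse (\<phi> k) * w i1 i2 k * w i3 i2 k * w i3 i4 k * w i1 i4 k)
      = (if i2 = i4 then \<phi> i1 * \<phi> i2 * \<phi> i3 else 0) + (if i1 = i3 then \<phi> i1 * \<phi> i2 * \<phi> i4 else 0)"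
  using assms
proof (cases rule: square_cases)
  case (vertex l)
  have "(\<Sum>k\<in>common_nbrs n {Suc l}. inverse (\<phi> k) * (w (Suc l) (Suc l) k * w (Suc l) (Suc l) k * w (Suc l) (Suc l) k * w (Suc l) (Suc l) k))
      = 2 * \<phi> (Suc l) * \<phi> (Suc l) * \<phi> (Suc l)"
    using vertex(1) vertex_equations(2)[of l]
    by (subst sum_common_nbrs_vertex) (simp_all add: w_boundary, simp_all add: W_verts_simps)
  then show ?thesis
    using vertex(2-) by (simp add: mult.assoc)
next
  case (edge l)
  have i: "i1 \<in> {l, Suc l}" "i2 \<in> {l, Suc l}" "i3 \<in> {l, Suc l}" "i4 \<in> {l, Suc l}"
    using edge(3) by blast+
  note E = edge_equations[OF edge(1,2)]
  have "common_nbrs n {i1, i2, i3, i4} = {l, Suc l}"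
    unfolding edge(3) using edge(1,2) by (rule common_nbrs_edge)
  then have "(\<Sum>k\<in>common_nbrs n {i1, i2, i3, i4}. inverse (\<phi> k) * w i1 i2 k * w i3 i2 k * w i3 i4 k * w i1 i4 k)
      = inverse (\<phi> l) * (w i1 i2 l * w i3 i2 l * w i3 i4 l * w i1 i4 l)
        + inverse (\<phi> (Suc l)) * (w i1 i2 (Suc l) * w i3 i2 (Suc l) * w i3 i4 (Suc l) * w i1 i4 (Suc l))"
    by (simp add: mult.assoc)
  moreover have "l \<in> {i1, i2, i3, i4}" "Suc l \<in> {i1, i2, i3, i4}"
    unfolding edge(3) by simp_all
  then have ne: "\<not> (i1 = l \<and> i2 = l \<and> i3 = l \<and> i4 = l)"
    "\<not> (i1 = Suc l \<and> i2 = Suc l \<and> i3 = Suc l \<and> i4 = Suc l)"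
    by auto
  \<comment> \<open>Of the sixteen placements of the corners on \<open>l\<close> and \<open>l + 1\<close>, fourteen remain; each of them
    is one of the four type II equations of the edge with its factors permuted.\<close>
  have "inverse (\<phi> l) * (w i1 i2 l * w i3 i2 l * w i3 i4 l * w i1 i4 l)
        + inverse (\<phi> (Suc l)) * (w i1 i2 (Suc l) * w i3 i2 (Suc l) * w i3 i4 (Suc l) * w i1 i4 (Suc l))
      = (if i2 = i4 then \<phi> i1 * \<phi> i2 * \<phi> i3 else 0) + (if i1 = i3 then \<phi> i1 * \<phi> i2 * \<phi> i4 else 0)"
    using i ne unfolding insert_iff empty_iff
    by (elim disjE FalseE; simp only: W_verts_simps simp_thms if_True if_False n_not_Suc_n Suc_n_not_n)
      (insert E, (simp (no_asm_use) only: mult_ac add_ac distrib_left add_0_left add_0_right; assumption)+)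
  ultimately show ?thesis
    by (simp only:)
next
  case (path l)
  note E = path_equation[OF path(1,2)]
  have "{i1, i2, i3, i4} = {l, Suc l, Suc (Suc l)}"
    using path(3) by auto
  then have "common_nbrs n {i1, i2, i3, i4} = {Suc l}"
    using common_nbrs_path[OF path(1,2)] by simp
  then have "(\<Sum>k\<in>common_nbrs n {i1, i2, i3, i4}. inverse (\<phi> k) * w i1 i2 k * w i3 i2 k * w i3 i4 k * w i1 i4 k)
      = inverse (\<phi> (Suc l)) * (w i1 i2 (Suc l) * w i3 i2 (Suc l) * w i3 i4 (Suc l) * w i1 i4 (Suc l))"
    by (simp add: mult.assoc)
  then show ?thesis
    using path(3) E by (auto simp: W_verts_simps doubleton_eq_iff mult_ac)
qed

lemma cell_system_W_pm: "cell_system (A_star n) (q_root n) \<phi> (W_pm n \<epsilon>)"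
  unfolding cell_system_A_star_iff tri_W_pm complex_cnj_complex_of_real of_real_qn[symmetric]
proof (intro conjI allI impI pf_digraph_A_star)
  fix x y z
  assume "nbr n x y" "nbr n y z" "nbr n z x"
  then show "complex_of_real (w y z x) = complex_of_real (w x y z)"
    by (cases rule: triangle_cases) (auto simp: W_verts_simps)
next
  fix i j
  assume "nbr n i j"
  from arg_cong[OF real_type_I[OF this], of complex_of_real]
  show "(\<Sum>k\<in>common_nbrs n {i, j}. complex_of_real (w i j k) * complex_of_real (w i j k))
      = complex_of_real (qn n 2) * \<phi> i * \<phi> j"
    by simp
next
  fix i1 i2 i3 i4
  assume "nbr n i1 i2" "nbr n i3 i2" "nbr n i3 i4" "nbr n i1 i4"
  from arg_cong[OF real_type_II[OF this], of complex_of_real]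
  show "(\<Sum>k\<in>common_nbrs n {i1, i2, i3, i4}. inverse (complex_of_real (\<phi> k))
           * complex_of_real (w i1 i2 k) * complex_of_real (w i3 i2 k)
           * complex_of_real (w i3 i4 k) * complex_of_real (w i1 i4 k))
        = (if i2 = i4 then complex_of_real (\<phi> i1 * \<phi> i2 * \<phi> i3) else 0)
          + (if i1 = i3 then complex_of_real (\<phi> i1 * \<phi> i2 * \<phi> i4) else 0)"
    by (simp only: of_real_sum of_real_mult of_real_inverse of_real_add if_distrib[of complex_of_real] of_real_0)
qed

lemma cell_equiv_W_pm:
  assumes "cell_system (A_star n) (q_root n) \<phi> W"
    and "n \<ge> 2 \<Longrightarrow> cmod (tri W 1 1 (Suc 1)) = cmod (tri (W_pm n \<epsilon>) 1 1 (Suc 1))"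
  shows "cell_equiv (A_star n) W (W_pm n \<epsilon>)"
  using assms(1) cell_system_W_pm n _ _ _ assms(2)
  by (rule cell_system_rigid) (auto simp: tri_W_pm W_verts_simps abc_nonzero)

end

section \<open>Classification\<close>

theorem theorem7p3:
  fixes n :: nat
  assumes "n \<ge> 1"
  shows "cell_system (A_star n) (q_root n) (phi_star n) (W_plus n)
    \<and> cell_system (A_star n) (q_root n) (phi_star n) (W_minus n)
    \<and> (\<forall>W. cell_system (A_star n) (q_root n) (phi_star n) W \<longrightarrow>
          cell_equiv (A_star n) W (W_plus n) \<or> cell_equiv (A_star n) W (W_minus n))
    \<and> (n \<ge> 2 \<longrightarrow> \<not> cell_equiv (A_star n) (W_plus n) (W_minus n))"
proof -
  interpret plus: root_with_sign n 1
    using assms by unfold_locales auto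
  interpret minus: root_with_sign n "- 1"
    using assms by unfold_locales auto
  have plus: "cell_system (A_star n) (q_root n) (phi_star n) (W_plus n)"
    unfolding W_plus_def by (rule plus.cell_system_W_pm)
  have minus: "cell_system (A_star n) (q_root n) (phi_star n) (W_minus n)"
    unfolding W_minus_def by (rule minus.cell_system_W_pm)
  have distinct: "cmod (tri (W_plus n) 1 1 (Suc 1)) \<noteq> cmod (tri (W_minus n) 1 1 (Suc 1))" if "n \<ge> 2"
  proof
    assume "cmod (tri (W_plus n) 1 1 (Suc 1)) = cmod (tri (W_minus n) 1 1 (Suc 1))"
    then have "\<bar>W_i_i_Si n 1 1\<bar> = \<bar>W_i_i_Si n (- 1) 1\<bar>"
      unfolding W_plus_def W_minus_def tri_W_pm W_verts_simps norm_of_real .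
    then have "\<bar>sqrt (qn n 2 - 1)\<bar> = \<bar>sqrt (qn n 2 + 1)\<bar>"
      using plus.abc_nonzero(2)[of 1] that 
      by (auto simp: W_i_i_Si_def abs_mult plus.qn_1)
    then show False
      using plus.qn_2_pos unfolding abs_eq_iff real_sqrt_minus[symmetric] real_sqrt_eq_iff by auto
  qed
  have edge12: "nbr n 1 1" "nbr n 1 (Suc 1)" "nbr n (Suc 1) 1" if "n \<ge> 2"
    using that by (auto simp: nbr_def)
  have "cell_equiv (A_star n) W (W_plus n) \<or> cell_equiv (A_star n) W (W_minus n)"
    if W: "cell_system (A_star n) (q_root n) (phi_star n) W" for W
  proof (cases "n \<ge> 2")
    case True
    then have "cmod (tri W 1 1 (Suc 1)) = cmod (tri (W_plus n) 1 1 (Suc 1))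
        \<or> cmod (tri W 1 1 (Suc 1)) = cmod (tri (W_minus n) 1 1 (Suc 1))"
      by (intro cell_system_modulus_dichotomy[OF W plus minus] distinct) auto
    then show ?thesis
      using plus.cell_equiv_W_pm[OF W] minus.cell_equiv_W_pm[OF W] unfolding W_plus_def W_minus_def by blast
  next
    case False
    then show ?thesis
      using plus.cell_equiv_W_pm[OF W] unfolding W_plus_def by blast
  qed
  moreover have "\<not> cell_equiv (A_star n) (W_plus n) (W_minus n)" if "n \<ge> 2"
    using cell_equiv_cmod_tri[OF _ edge12[OF that]] distinct[OF that] by blast
  ultimately show ?thesis
    using plus minus by blast
qed

end
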